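(* Let $q\in\mathbb C^\times$ be not a root of unity. Let $a(z)$ and $b(z)$ be complex polynomials of even degree with non-zero constant terms, and let $ab$ be the product polynomial. Then, in the quantum affine algebra $U_q$ of $\mathfrak{sl}_2$ (with $\Delta$ applied coefficientwise), $$\Delta(\mathscr A^{ab-}(z))=\mathscr A^{a-}(z)\otimes\mathscr A^{b-}(z)+q^{-1}z\,[\mathscr A^{a-}(z),x^-_1]\otimes[x^+_0,\mathscr A^{b-}(z)],$$ $$\Delta(\mathscr A^{ab+}(z))=\mathscr A^{a+}(z)\otimes\mathscr A^{b+}(z)+qz^{-1}\,[\mathscr A^{a+}(z),x^-_0]\otimes[x^+_{-1},\mathscr A^{b+}(z)].$$
   Context: All algebras are associative unital over $\mathbb C$, $\otimes=\otimes_{\mathbb C}$, $\mathbb N=\{0,1,2,\dots\}$, $[x,y]=xy-yx$. $U_q$ is the algebra with generators $x^\pm_m,\phi^\pm_m$ ($m\in\mathbb Z$) and relations, for $\epsilon\in\{+,-\}$, $m,n\in\mathbb Z$: $\phi^+_m=0$ if $m<0$; $\phi^-_m=0$ if $m>0$; $\phi^+_0\phi^-_0=1$; $[\phi^\pm_m,\phi^\epsilon_n]=0$; $[x^+_m,x^-_n]=\dfrac{\phi^+_{m+n}-\phi^-_{m+n}}{q-q^{-1}}$; $\phi^\epsilon_{m+1}x^\pm_n-q^{\pm2}\phi^\epsilon_mx^\pm_{n+1}=q^{\pm2}x^\pm_n\phi^\epsilon_{m+1}-x^\pm_{n+1}\phi^\epsilon_m$; $x^\pm_{m+1}x^\pm_n-q^{\pm2}x^\pm_mx^\pm_{n+1}=q^{\pm2}x^\pm_nx^\pm_{m+1}-x^\pm_{n+1}x^\pm_m$.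 Put $\phi^\pm(z)=\sum_{n\in\mathbb Z}\phi^\pm_nz^n$, and define $h_s$ ($s\in\mathbb Z\setminus\{0\}$) by $\phi^\pm(z)=\phi^\pm_0\exp\big(\pm(q-q^{-1})\sum_{\pm s>0}h_sz^s\big)$. $U_q$ is a Hopf algebra whose coproduct is the algebra morphism determined by $\Delta(x^+_0)=x^+_0\otimes1+\phi^+_0\otimes x^+_0$, $\Delta(x^-_0)=1\otimes x^-_0+x^-_0\otimes\phi^-_0$, $\Delta(\phi^\pm_0)=\phi^\pm_0\otimes\phi^\pm_0$, $\Delta(h_{-1})=1\otimes h_{-1}+h_{-1}\otimes1+(q^2-q^{-2})x^-_0\otimes x^+_{-1}$, $\Delta(h_1)=1\otimes h_1+h_1\otimes1-(q^2-q^{-2})x^-_1\otimes x^+_0$. For $n\in\mathbb N$ and a complex polynomial $a(z)$ with dominant term $a_{2n}z^{2n}$ and non-zero constant term $a_0$, the series $\mathscr A^{a+}(z)$ and $\mathscr A^{a-}(z)$ are the power series with constant term $1$ in $z$ and in $z^{-1}$ respectively, with coefficients in the commutative subalgebra generated by the $\phi^\pm_m$, determined by $$\phi^+(z)=\frac{\phi^+_0a(z)a_0^{-1}}{\mathscr A^{a+}(z)\mathscr A^{a+}(zq^2)},\qquad \phi^-(z)=\frac{\phi^-_0a(z)a_{2n}^{-1}z^{-2n}}{\mathscr A^{a-}(z)\mathscr A^{a-}(zq^2)}.$$ For series $f(z)=\sum f_iz^i$, $g(z)=\sum g_jz^j$ over $U_q$ (both in $z$ or both in $z^{-1}$), $f(z)\otimes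 g(z)=\sum_{i,j}f_i\otimes g_j\,z^{i+j}$. *)

theory Defs
  imports
    Complex_Main
    "HOL-Library.Poly_Mapping"
    "HOL-Computational_Algebra.Formal_Laurent_Series"
    "HOL-Computational_Algebra.Polynomial_FPS"
begin

section \<open>Complex vector spaces and associative unital complex algebras\<close>

class complex_vector = ab_group_add +
  fixes scaleC :: "complex \<Rightarrow> 'a \<Rightarrow> 'a"  (infixr \<open>*\<^sub>C\<close> 75)
  assumes scaleC_add_right: "c *\<^sub>C (x + y) = c *\<^sub>C x + c *\<^sub>C y"
    and scaleC_add_left: "(c + d) *\<^sub>C x = c *\<^sub>C x + d *\<^sub>C x"
    and scaleC_scaleC: "c *\<^sub>C d *\<^sub>C x = (c * d) *\<^sub>C x"
    and scaleC_one: "1 *\<^sub>C x = x"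

class complex_algebra_1 = complex_vector + ring_1 +
  assumes mult_scaleC_left: "(c *\<^sub>C x) * y = c *\<^sub>C (x * y)"
    and mult_scaleC_right: "x * (c *\<^sub>C y) = c *\<^sub>C (x * y)"

global_interpretation cvec: vector_space "scaleC :: complex \<Rightarrow> 'a \<Rightarrow> 'a :: complex_vector"
  by unfold_locales
    (simp_all add: scaleC_add_right scaleC_add_left scaleC_scaleC scaleC_one)

instantiation complex :: complex_algebra_1
begin

definition scaleC_complex :: "complex \<Rightarrow> complex \<Rightarrow> complex"
  where "scaleC_complex = (*)"

instance
  by standard (simp_all add: scaleC_complex_def algebra_simps)

end

definition algebra_hom :: "('a::complex_algebra_1 \<Rightarrow> 'b::complex_algebra_1) \<Rightarrow> bool" where
  "algebra_hom f \<longleftrightarrow>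
     (\<forall>x y. f (x + y) = f x + f y) \<and> (\<forall>c x. f (c *\<^sub>C x) = c *\<^sub>C f x) \<and>
     (\<forall>x y. f (x * y) = f x * f y) \<and> f 1 = 1"

definition commutator :: "'a::ring \<Rightarrow> 'a \<Rightarrow> 'a" where
  "commutator x y = x * y - y * x"

inductive_set generated_subalgebra :: "'a::complex_algebra_1 set \<Rightarrow> 'a set" for S where
  gen: "x \<in> S \<Longrightarrow> x \<in> generated_subalgebra S"
| one: "1 \<in> generated_subalgebra S"
| add: "x \<in> generated_subalgebra S \<Longrightarrow> y \<in> generated_subalgebra S \<Longrightarrow>
    x + y \<in> generated_subalgebra S"
| mult: "x \<in> generated_subalgebra S \<Longrightarrow> y \<in> generated_subalgebra S \<Longrightarrow>
    x * y \<in> generated_subalgebra S"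
| scale: "x \<in> generated_subalgebra S \<Longrightarrow> c *\<^sub>C x \<in> generated_subalgebra S"

inductive_set generated_ideal :: "'a::ring_1 set \<Rightarrow> 'a set" for R where
  zero: "0 \<in> generated_ideal R"
| gen: "r \<in> R \<Longrightarrow> x * r * y \<in> generated_ideal R"
| add: "x \<in> generated_ideal R \<Longrightarrow> y \<in> generated_ideal R \<Longrightarrow> x + y \<in> generated_ideal R"


section \<open>Finitely supported functions as complex vector spaces and algebras\<close>

instantiation poly_mapping :: (type, complex_vector) complex_vector
begin

lift_definition scaleC_poly_mapping :: "complex \<Rightarrow> ('a \<Rightarrow>\<^sub>0 'b) \<Rightarrow> 'a \<Rightarrow>\<^sub>0 'b"
  is "\<lambda>c f k. c *\<^sub>C f k"
proof -
  fix c :: complex and f :: "'a \<Rightarrow> 'b"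
  assume "finite {k. f k \<noteq> 0}"
  then show "finite {k. c *\<^sub>C f k \<noteq> 0}"
    by (rule rev_finite_subset) auto
qed

instance
  by standard
    (transfer; simp add: scaleC_add_right scaleC_add_left scaleC_scaleC scaleC_one)+

end

lemma scaleC_single: "c *\<^sub>C Poly_Mapping.single k v = Poly_Mapping.single k (c *\<^sub>C v)"
  by (transfer; auto simp: when_def)

lemma poly_mapping_single_induct [case_names single add]:
  assumes "\<And>k v. P (Poly_Mapping.single k v)"
    and "\<And>p r. P p \<Longrightarrow> P r \<Longrightarrow> P (p + r)"
  shows "P (p :: 'k \<Rightarrow>\<^sub>0 'v::comm_monoid_add)"
proof -
  have sums: "P (\<Sum>k\<in>A. Poly_Mapping.single k (f k))" if "finite A" for A :: "'k set" and f
    using that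
  proof (induction A)
    case empty
    show ?case using assms(1)[of undefined 0] by simp
  next
    case (insert x F)
    then show ?case using assms by simp
  qed
  have "p = (\<Sum>k\<in>Poly_Mapping.keys p. Poly_Mapping.single k (Poly_Mapping.lookup p k))"
    by (rule poly_mapping_eqI)
      (simp add: lookup_sum lookup_single when_def in_keys_iff)
  then show ?thesis
    using sums[of "Poly_Mapping.keys p" "Poly_Mapping.lookup p"] by simp
qed

lemma mult_scaleC_poly_mapping:
  fixes p r :: "'a::monoid_add \<Rightarrow>\<^sub>0 'b::complex_algebra_1"
  shows "(c *\<^sub>C p) * r = c *\<^sub>C (p * r)" "p * (c *\<^sub>C r) = c *\<^sub>C (p * r)"
proof -
  have 1: "(c *\<^sub>C Poly_Mapping.single k v) * r = c *\<^sub>C (Poly_Mapping.single k v * r)" for k v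
    by (induction r rule: poly_mapping_single_induct)
      (simp_all add: scaleC_single mult_single mult_scaleC_left distrib_left scaleC_add_right)
  show "(c *\<^sub>C p) * r = c *\<^sub>C (p * r)"
    by (induction p rule: poly_mapping_single_induct)
      (simp_all add: 1 scaleC_add_right distrib_right)
  have 2: "Poly_Mapping.single k v * (c *\<^sub>C r) = c *\<^sub>C (Poly_Mapping.single k v * r)" for k v
    by (induction r rule: poly_mapping_single_induct)
      (simp_all add: scaleC_single mult_single mult_scaleC_right distrib_left scaleC_add_right)
  show "p * (c *\<^sub>C r) = c *\<^sub>C (p * r)"
    by (induction p rule: poly_mapping_single_induct)
      (simp_all add: 2 scaleC_add_right distrib_right)
qed

instance poly_mapping :: (monoid_add, complex_algebra_1) complex_algebra_1
  by standard (simp_all add: mult_scaleC_poly_mapping)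

definition linear_extension :: "('k \<Rightarrow> 'v::complex_vector) \<Rightarrow> ('k \<Rightarrow>\<^sub>0 complex) \<Rightarrow> 'v" where
  "linear_extension f p =
     (\<Sum>k\<in>Poly_Mapping.keys p. Poly_Mapping.lookup p k *\<^sub>C f k)"


section \<open>Free algebras and presentations\<close>

text \<open>
  Words are written additively, so that the convolution product on finitely supported
  functions on words is the product of the free algebra.
\<close>

datatype 'g mono = Mono (letters: "'g list")

instantiation mono :: (type) monoid_add
begin

definition zero_mono :: "'a mono" where "0 = Mono []"

definition plus_mono :: "'a mono \<Rightarrow> 'a mono \<Rightarrow> 'a mono"
  where "v + w = Mono (letters v @ letters w)"

instance
  by standard (simp_all add: zero_mono_def plus_mono_def)

end

type_synonym 'g free_algebra = "'g mono \<Rightarrow>\<^sub>0 complex"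

definition free_gen :: "'g \<Rightarrow> 'g free_algebra" where
  "free_gen g = Poly_Mapping.single (Mono [g]) 1"

definition free_eval :: "('g \<Rightarrow> 'a::complex_algebra_1) \<Rightarrow> 'g free_algebra \<Rightarrow> 'a" where
  "free_eval u = linear_extension (\<lambda>w. prod_list (map u (letters w)))"

text \<open>
  The algebra \<open>'a\<close>, with distinguished elements \<open>u\<close>, is the algebra with generators
  \<open>'g\<close> and relations \<open>r = 0\<close> for \<open>r \<in> R\<close>: evaluation identifies it with the quotient
  of the free algebra by the two-sided ideal generated by \<open>R\<close>.
\<close>

definition presented_by :: "('g \<Rightarrow> 'a::complex_algebra_1) \<Rightarrow> 'g free_algebra set \<Rightarrow> bool" where
  "presented_by u R \<longleftrightarrow> surj (free_eval u) \<and> {p. free_eval u p = 0} = generated_ideal R"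


section \<open>The tensor product of two algebras\<close>

text \<open>
  The tensor product is the quotient of the free vector space on the set of pairs by
  the subspace spanned by the bilinearity relations.  Pairs are given the componentwise
  product, written additively, so that convolution induces
  \<open>(a \<otimes> b) (c \<otimes> d) = a c \<otimes> b d\<close> on the quotient.
\<close>

datatype ('a, 'b) tensor_pair = TPair (tfst: 'a) (tsnd: 'b)

instantiation tensor_pair :: (monoid_mult, monoid_mult) monoid_add
begin

definition zero_tensor_pair :: "('a, 'b) tensor_pair" where "0 = TPair 1 1"

definition plus_tensor_pair ::
  "('a, 'b) tensor_pair \<Rightarrow> ('a, 'b) tensor_pair \<Rightarrow> ('a, 'b) tensor_pair"
  where "v + w = TPair (tfst v * tfst w) (tsnd v * tsnd w)"

instance
  by standard (simp_all add: zero_tensor_pair_def plus_tensor_pair_def mult.assoc)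

end

abbreviation free_pair :: "'a \<Rightarrow> 'b \<Rightarrow> ('a, 'b) tensor_pair \<Rightarrow>\<^sub>0 complex" where
  "free_pair a b \<equiv> Poly_Mapping.single (TPair a b) 1"

definition bilinear_relators ::
  "(('a::complex_vector, 'b::complex_vector) tensor_pair \<Rightarrow>\<^sub>0 complex) set" where
  "bilinear_relators =
     {free_pair (a + a') b - free_pair a b - free_pair a' b | a a' b. True} \<union>
     {free_pair a (b + b') - free_pair a b - free_pair a b' | a b b'. True} \<union>
     {free_pair (c *\<^sub>C a) b - c *\<^sub>C free_pair a b | c a b. True} \<union>
     {free_pair a (c *\<^sub>C b) - c *\<^sub>C free_pair a b | c a b. True}"

definition tensor_eq ::
  "(('a::complex_vector, 'b::complex_vector) tensor_pair \<Rightarrow>\<^sub>0 complex) \<Rightarrow>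
   (('a, 'b) tensor_pair \<Rightarrow>\<^sub>0 complex) \<Rightarrow> bool" where
  "tensor_eq p r \<longleftrightarrow> p - r \<in> cvec.span bilinear_relators"

lemma equivp_tensor_eq:
  "equivp (tensor_eq ::
     (('a::complex_vector, 'b::complex_vector) tensor_pair \<Rightarrow>\<^sub>0 complex) \<Rightarrow> _)"
proof (rule equivpI)
  show "reflp (tensor_eq :: (('a, 'b) tensor_pair \<Rightarrow>\<^sub>0 complex) \<Rightarrow> _)"
    by (rule reflpI) (simp add: tensor_eq_def cvec.span_zero)
  show "symp (tensor_eq :: (('a, 'b) tensor_pair \<Rightarrow>\<^sub>0 complex) \<Rightarrow> _)"
    unfolding tensor_eq_def by (rule sympI) (metis cvec.span_neg minus_diff_eq)
  show "transp (tensor_eq :: (('a, 'b) tensor_pair \<Rightarrow>\<^sub>0 complex) \<Rightarrow> _)"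
  proof (rule transpI)
    fix p r t :: "('a, 'b) tensor_pair \<Rightarrow>\<^sub>0 complex"
    assume "tensor_eq p r" "tensor_eq r t"
    then have "(p - r) + (r - t) \<in> cvec.span bilinear_relators"
      unfolding tensor_eq_def by (rule cvec.span_add)
    then show "tensor_eq p t" by (simp add: tensor_eq_def)
  qed
qed

quotient_type (overloaded) ('a, 'b) tensor =
  "('a::complex_algebra_1, 'b::complex_algebra_1) tensor_pair \<Rightarrow>\<^sub>0 complex" / tensor_eq
  by (rule equivp_tensor_eq)

lift_definition tensor_pure ::
  "'a::complex_algebra_1 \<Rightarrow> 'b::complex_algebra_1 \<Rightarrow> ('a, 'b) tensor"  (infixl \<open>\<otimes>\<^sub>C\<close> 75)
  is free_pair .

lemma bilinear_relators_mult_single: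
  fixes p :: "('a::complex_algebra_1, 'b::complex_algebra_1) tensor_pair \<Rightarrow>\<^sub>0 complex"
  assumes "p \<in> bilinear_relators"
  shows "p * free_pair a b \<in> bilinear_relators" "free_pair a b * p \<in> bilinear_relators"
  using assms unfolding bilinear_relators_def
  by (auto simp: left_diff_distrib right_diff_distrib mult_single plus_tensor_pair_def
      mult_scaleC_left mult_scaleC_right distrib_left distrib_right; blast)+

lemma single_tensor_pair:
  "Poly_Mapping.single k v = v *\<^sub>C free_pair (tfst k) (tsnd k)"
  by (simp add: scaleC_single scaleC_complex_def)

lemma span_bilinear_relators_mult:
  fixes p r :: "('a::complex_algebra_1, 'b::complex_algebra_1) tensor_pair \<Rightarrow>\<^sub>0 complex"
  assumes "p \<in> cvec.span bilinear_relators"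
  shows "p * r \<in> cvec.span bilinear_relators" "r * p \<in> cvec.span bilinear_relators"
proof -
  have 1: "p * free_pair a b \<in> cvec.span bilinear_relators" for a b
    using assms
    by (induction rule: cvec.span_induct_alt)
      (simp_all add: distrib_right mult_scaleC_left bilinear_relators_mult_single
        cvec.span_zero cvec.span_add cvec.span_scale cvec.span_base)
  have "p * Poly_Mapping.single k v \<in> cvec.span bilinear_relators" for k v
    by (subst single_tensor_pair) (simp only: mult_scaleC_right 1 cvec.span_scale)
  then show "p * r \<in> cvec.span bilinear_relators"
    by (induction r rule: poly_mapping_single_induct) (simp_all add: distrib_left cvec.span_add)
  have 2: "free_pair a b * p \<in> cvec.span bilinear_relators" for a b
    using assms
    by (induction rule: cvec.span_induct_alt)
      (simp_all add: distrib_left mult_scaleC_right bilinear_relators_mult_single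
        cvec.span_zero cvec.span_add cvec.span_scale cvec.span_base)
  have "Poly_Mapping.single k v * p \<in> cvec.span bilinear_relators" for k v
    by (subst single_tensor_pair) (simp only: mult_scaleC_left 2 cvec.span_scale)
  then show "r * p \<in> cvec.span bilinear_relators"
    by (induction r rule: poly_mapping_single_induct) (simp_all add: distrib_right cvec.span_add)
qed

lemma exists_functional:
  fixes x :: "'a::complex_vector"
  assumes "x \<noteq> 0"
  obtains f :: "'a \<Rightarrow> complex" where "\<And>y z. f (y + z) = f y + f z"
    and "\<And>c y. f (c *\<^sub>C y) = c * f y" and "f x = 1"
proof -
  interpret P: vector_space_pair "scaleC :: complex \<Rightarrow> 'a \<Rightarrow> 'a"
    "scaleC :: complex \<Rightarrow> complex \<Rightarrow> complex" ..
  have "cvec.independent {x}"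
    using assms by (simp add: cvec.independent_insert)
  from P.linear_independent_extend[OF this, of "\<lambda>_. 1"]
  obtain g where g: "Vector_Spaces.linear (*\<^sub>C) (*\<^sub>C) g" "g x = (1::complex)" by auto
  interpret g: Vector_Spaces.linear scaleC scaleC g by (rule g)
  show thesis
    by (rule that[of g]) (simp_all add: g.add g.scale g(2) scaleC_complex_def)
qed

lemma linear_extension_superset:
  assumes "finite A" "Poly_Mapping.keys p \<subseteq> A"
  shows "linear_extension f p = (\<Sum>k\<in>A. Poly_Mapping.lookup p k *\<^sub>C f k)"
  unfolding linear_extension_def using assms
  by (intro sum.mono_neutral_left) (auto simp: in_keys_iff)

lemma linear_extension_single: "linear_extension f (Poly_Mapping.single k c) = c *\<^sub>C f k"
  by (simp add: linear_extension_def)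

lemma linear_extension_add:
  "linear_extension f (p + r) = linear_extension f p + linear_extension f r"
proof -
  let ?A = "Poly_Mapping.keys p \<union> Poly_Mapping.keys r"
  have "Poly_Mapping.keys (p + r) \<subseteq> ?A" by (rule Poly_Mapping.keys_add)
  then show ?thesis
    by (simp add: linear_extension_superset[of ?A] lookup_add scaleC_add_left sum.distrib)
qed

lemma linear_extension_scaleC: "linear_extension f (c *\<^sub>C p) = c *\<^sub>C linear_extension f p"
  by (induction p rule: poly_mapping_single_induct)
    (simp_all add: scaleC_single linear_extension_single linear_extension_add scaleC_add_right
      scaleC_scaleC scaleC_complex_def)

lemma linear_extension_diff:
  "linear_extension f (p - r) = linear_extension f p - linear_extension f r"
  using linear_extension_add[of f "p - r" r] by (simp add: algebra_simps)

lemma one_notin_span_bilinear_relators: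
  "(1 :: ('a::complex_algebra_1, 'b::complex_algebra_1) tensor_pair \<Rightarrow>\<^sub>0 complex)
     \<notin> cvec.span bilinear_relators"
proof
  assume *: "(1 :: ('a, 'b) tensor_pair \<Rightarrow>\<^sub>0 complex) \<in> cvec.span bilinear_relators"
  obtain f :: "'a \<Rightarrow> complex" where f: "\<And>y z. f (y + z) = f y + f z"
    "\<And>c y. f (c *\<^sub>C y) = c * f y" "f 1 = 1"
    by (rule exists_functional[of "1::'a"]) (simp, blast)
  obtain g :: "'b \<Rightarrow> complex" where g: "\<And>y z. g (y + z) = g y + g z"
    "\<And>c y. g (c *\<^sub>C y) = c * g y" "g 1 = 1"
    by (rule exists_functional[of "1::'b"]) (simp, blast)
  define h where "h = linear_extension (\<lambda>k. f (tfst k) * g (tsnd k))"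
  have "h p = 0" if "p \<in> cvec.span bilinear_relators" for p
    using that
  proof (induction rule: cvec.span_induct_alt)
    case base
    show ?case by (simp add: h_def linear_extension_def)
  next
    case (step c x y)
    from step(1) have "h x = 0"
      by (auto simp: bilinear_relators_def h_def linear_extension_diff linear_extension_scaleC
          linear_extension_single f g scaleC_complex_def distrib_left distrib_right)
    with step show ?case
      by (simp add: h_def linear_extension_add linear_extension_scaleC)
  qed
  from this[OF *] have "h 1 = 0" .
  moreover have "h 1 = 1"
    by (simp add: h_def single_one[symmetric] linear_extension_single zero_tensor_pair_def
        f g scaleC_complex_def del: single_one)
  ultimately show False by simp
qed

instantiation tensor :: (complex_algebra_1, complex_algebra_1) complex_algebra_1
begin

lift_definition zero_tensor :: "('a, 'b) tensor" is 0 .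

lift_definition one_tensor :: "('a, 'b) tensor" is 1 .

lift_definition plus_tensor :: "('a, 'b) tensor \<Rightarrow> ('a, 'b) tensor \<Rightarrow> ('a, 'b) tensor" is "(+)"
  unfolding tensor_eq_def by (metis cvec.span_add add_diff_add)

lift_definition uminus_tensor :: "('a, 'b) tensor \<Rightarrow> ('a, 'b) tensor" is uminus
  unfolding tensor_eq_def by (metis cvec.span_neg minus_diff_minus)

lift_definition minus_tensor :: "('a, 'b) tensor \<Rightarrow> ('a, 'b) tensor \<Rightarrow> ('a, 'b) tensor" is "(-)"
proof -
  fix p p' r r' :: "('a, 'b) tensor_pair \<Rightarrow>\<^sub>0 complex"
  assume "tensor_eq p p'" "tensor_eq r r'"
  moreover have "p - r - (p' - r') = (p - p') - (r - r')"
    by simp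
  ultimately show "tensor_eq (p - r) (p' - r')"
    by (simp only: tensor_eq_def cvec.span_diff)
qed

lift_definition scaleC_tensor :: "complex \<Rightarrow> ('a, 'b) tensor \<Rightarrow> ('a, 'b) tensor" is "scaleC"
  unfolding tensor_eq_def by (metis cvec.span_scale cvec.scale_right_diff_distrib)

lift_definition times_tensor :: "('a, 'b) tensor \<Rightarrow> ('a, 'b) tensor \<Rightarrow> ('a, 'b) tensor" is "(*)"
proof -
  fix p p' r r' :: "('a, 'b) tensor_pair \<Rightarrow>\<^sub>0 complex"
  assume "tensor_eq p p'" "tensor_eq r r'"
  moreover have "p * r - p' * r' = (p - p') * r + p' * (r - r')"
    by (simp add: algebra_simps)
  ultimately show "tensor_eq (p * r) (p' * r')"
    by (simp add: tensor_eq_def cvec.span_add span_bilinear_relators_mult)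
qed

instance
proof
  show "(0 :: ('a, 'b) tensor) \<noteq> 1"
    by transfer
      (use one_notin_span_bilinear_relators cvec.span_neg in \<open>fastforce simp: tensor_eq_def\<close>)
qed (transfer; simp add: tensor_eq_def algebra_simps cvec.span_zero scaleC_add_right
      scaleC_add_left scaleC_scaleC scaleC_one mult_scaleC_left mult_scaleC_right)+

end

lemma tensor_pure_mult: "(a \<otimes>\<^sub>C b) * (c \<otimes>\<^sub>C d) = (a * c) \<otimes>\<^sub>C (b * d)"
  by transfer (simp add: mult_single plus_tensor_pair_def tensor_eq_def cvec.span_zero)

lemma tensor_pure_one: "1 \<otimes>\<^sub>C 1 = 1"
  by transfer (simp add: tensor_eq_def single_one[symmetric] zero_tensor_pair_def cvec.span_zero
      del: single_one)

lemma tensor_pure_bilinear: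
  "(a + a') \<otimes>\<^sub>C b = a \<otimes>\<^sub>C b + a' \<otimes>\<^sub>C b" "a \<otimes>\<^sub>C (b + b') = a \<otimes>\<^sub>C b + a \<otimes>\<^sub>C b'"
  "(c *\<^sub>C a) \<otimes>\<^sub>C b = c *\<^sub>C (a \<otimes>\<^sub>C b)" "a \<otimes>\<^sub>C (c *\<^sub>C b) = c *\<^sub>C (a \<otimes>\<^sub>C b)"
  by (transfer; unfold tensor_eq_def diff_diff_eq[symmetric]; rule cvec.span_base;
      unfold bilinear_relators_def; blast)+


section \<open>Formal power series with coefficients in an algebra\<close>

definition fps_map :: "('a \<Rightarrow> 'b) \<Rightarrow> 'a fps \<Rightarrow> 'b fps" where
  "fps_map f F = Abs_fps (\<lambda>n. f (F $ n))"

definition fps_scalar :: "complex \<Rightarrow> 'a::complex_algebra_1 fps" where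
  "fps_scalar c = fps_const (c *\<^sub>C 1)"

text \<open>The series \<open>F(c z)\<close>.\<close>

definition fps_dilate :: "complex \<Rightarrow> 'a::complex_algebra_1 fps \<Rightarrow> 'a fps" where
  "fps_dilate c F = Abs_fps (\<lambda>n. c ^ n *\<^sub>C F $ n)"

text \<open>
  The exponential of a series with constant term zero; the coefficient of degree \<open>n\<close>
  of \<open>F ^ k\<close> then vanishes for \<open>k > n\<close>.
\<close>

definition fps_exponential :: "'a::complex_algebra_1 fps \<Rightarrow> 'a fps" where
  "fps_exponential F = Abs_fps (\<lambda>n. \<Sum>k\<le>n. (1 / fact k) *\<^sub>C (F ^ k) $ n)"

definition fps_tensor ::
  "'a::complex_algebra_1 fps \<Rightarrow> 'b::complex_algebra_1 fps \<Rightarrow> ('a, 'b) tensor fps" where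
  "fps_tensor F G = Abs_fps (\<lambda>n. \<Sum>i\<le>n. (F $ i) \<otimes>\<^sub>C (G $ (n - i)))"


section \<open>The quantum affine algebra\<close>

datatype sign = Pos | Neg

fun sign_int :: "sign \<Rightarrow> int" where
  "sign_int Pos = 1"
| "sign_int Neg = -1"

datatype uq_gen = GX sign int | GPhi sign int

text \<open>
  The relations, written as elements required to vanish, in terms of the families
  \<open>x s m\<close> and \<open>\<phi> e m\<close>.
\<close>

definition uq_relators ::
  "complex \<Rightarrow> (sign \<Rightarrow> int \<Rightarrow> 'a::complex_algebra_1) \<Rightarrow> (sign \<Rightarrow> int \<Rightarrow> 'a) \<Rightarrow> 'a set" where
  "uq_relators q x \<phi> =
     {\<phi> Pos m | m. m < 0} \<union> {\<phi> Neg m | m. m > 0} \<union>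
     {\<phi> Pos 0 * \<phi> Neg 0 - 1} \<union>
     {commutator (\<phi> s m) (\<phi> e n) | s e m n. True} \<union>
     {commutator (x Pos m) (x Neg n)
        - (1 / (q - inverse q)) *\<^sub>C (\<phi> Pos (m + n) - \<phi> Neg (m + n)) | m n. True} \<union>
     {(\<phi> e (m + 1) * x s n - q powi (2 * sign_int s) *\<^sub>C (\<phi> e m * x s (n + 1)))
        - (q powi (2 * sign_int s) *\<^sub>C (x s n * \<phi> e (m + 1)) - x s (n + 1) * \<phi> e m)
        | e s m n. True} \<union>
     {(x s (m + 1) * x s n - q powi (2 * sign_int s) *\<^sub>C (x s m * x s (n + 1)))
        - (q powi (2 * sign_int s) *\<^sub>C (x s n * x s (m + 1)) - x s (n + 1) * x s m)
        | s m n. True}"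

text \<open>The algebra \<open>'a\<close>, with the elements \<open>x s m\<close> and \<open>\<phi> e m\<close>, is \<open>U\<^sub>q\<close>.\<close>

definition quantum_affine_algebra ::
  "complex \<Rightarrow> (sign \<Rightarrow> int \<Rightarrow> 'a::complex_algebra_1) \<Rightarrow> (sign \<Rightarrow> int \<Rightarrow> 'a) \<Rightarrow> bool" where
  "quantum_affine_algebra q x \<phi> \<longleftrightarrow>
     presented_by (case_uq_gen x \<phi>)
       (uq_relators q (\<lambda>s m. free_gen (GX s m)) (\<lambda>e m. free_gen (GPhi e m)))"

text \<open>
  From here on, series in \<open>z\<close> (sign \<open>Pos\<close>) and in \<open>z\<inverse>\<close> (sign \<open>Neg\<close>)
  are both formal power series: the indeterminate is \<open>z\<close> in the first case and
  \<open>z\<inverse>\<close> in the second.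
\<close>

definition phi_series :: "(sign \<Rightarrow> int \<Rightarrow> 'a::complex_algebra_1) \<Rightarrow> sign \<Rightarrow> 'a fps" where
  "phi_series \<phi> e = Abs_fps (\<lambda>n. \<phi> e (sign_int e * int n))"

text \<open>The coefficient of degree \<open>n > 0\<close> is \<open>h\<^sub>n\<close> for sign \<open>Pos\<close> and \<open>h\<^sub>-\<^sub>n\<close> for sign \<open>Neg\<close>.\<close>

definition h_series ::
  "complex \<Rightarrow> (sign \<Rightarrow> int \<Rightarrow> 'a::complex_algebra_1) \<Rightarrow> sign \<Rightarrow> 'a fps" where
  "h_series q \<phi> e = (THE H. H $ 0 = 0 \<and>
     phi_series \<phi> e = fps_const (\<phi> e 0) *
       fps_exponential (fps_scalar (of_int (sign_int e) * (q - inverse q)) * H))"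

text \<open>The element \<open>h\<^sub>s\<close>, meaningful for \<open>s \<noteq> 0\<close> only.\<close>

definition h_elem ::
  "complex \<Rightarrow> (sign \<Rightarrow> int \<Rightarrow> 'a::complex_algebra_1) \<Rightarrow> int \<Rightarrow> 'a" where
  "h_elem q \<phi> s = h_series q \<phi> (if s > 0 then Pos else Neg) $ nat \<bar>s\<bar>"

text \<open>The five values determine the morphism, as these elements generate the algebra.\<close>

definition quantum_affine_coproduct ::
  "complex \<Rightarrow> (sign \<Rightarrow> int \<Rightarrow> 'a::complex_algebra_1) \<Rightarrow> (sign \<Rightarrow> int \<Rightarrow> 'a) \<Rightarrow>
   ('a \<Rightarrow> ('a, 'a) tensor) \<Rightarrow> bool" where
  "quantum_affine_coproduct q x \<phi> \<Delta> \<longleftrightarrow>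
     algebra_hom \<Delta> \<and>
     \<Delta> (x Pos 0) = x Pos 0 \<otimes>\<^sub>C 1 + \<phi> Pos 0 \<otimes>\<^sub>C x Pos 0 \<and>
     \<Delta> (x Neg 0) = 1 \<otimes>\<^sub>C x Neg 0 + x Neg 0 \<otimes>\<^sub>C \<phi> Neg 0 \<and>
     (\<forall>e. \<Delta> (\<phi> e 0) = \<phi> e 0 \<otimes>\<^sub>C \<phi> e 0) \<and>
     \<Delta> (h_elem q \<phi> (-1)) = 1 \<otimes>\<^sub>C h_elem q \<phi> (-1) + h_elem q \<phi> (-1) \<otimes>\<^sub>C 1
       + (q powi 2 - q powi (-2)) *\<^sub>C (x Neg 0 \<otimes>\<^sub>C x Pos (-1)) \<and>
     \<Delta> (h_elem q \<phi> 1) = 1 \<otimes>\<^sub>C h_elem q \<phi> 1 + h_elem q \<phi> 1 \<otimes>\<^sub>C 1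
       - (q powi 2 - q powi (-2)) *\<^sub>C (x Neg 1 \<otimes>\<^sub>C x Pos 0)"

text \<open>
  The series \<open>a(z) / a\<^sub>0\<close> in \<open>z\<close>, respectively \<open>a(z) z\<^sup>-\<^sup>d / a\<^sub>d\<close> in \<open>z\<inverse>\<close>, where
  \<open>d\<close> is the degree of \<open>a\<close>.
\<close>

fun normalized_poly_series :: "sign \<Rightarrow> complex poly \<Rightarrow> 'a::complex_algebra_1 fps" where
  "normalized_poly_series Pos a =
     fps_map (\<lambda>c. c *\<^sub>C 1) (fps_of_poly (smult (inverse (coeff a 0)) a))"
| "normalized_poly_series Neg a =
     fps_map (\<lambda>c. c *\<^sub>C 1) (fps_of_poly (smult (inverse (lead_coeff a)) (reflect_poly a)))"

text \<open>
  The series \<open>\<A>\<^sup>a\<^sup>\<plusminus>(z)\<close>.  The substitution \<open>z \<mapsto> z q\<^sup>2\<close> is \<open>z\<inverse> \<mapsto> q\<^sup>-\<^sup>2 z\<inverse>\<close>.  The quotient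
  in the defining equation is taken in series over a commutative algebra, with an
  invertible denominator (its constant term is 1), and is written in multiplied-out form.
\<close>

definition A_series ::
  "complex \<Rightarrow> (sign \<Rightarrow> int \<Rightarrow> 'a::complex_algebra_1) \<Rightarrow> sign \<Rightarrow> complex poly \<Rightarrow> 'a fps" where
  "A_series q \<phi> e a = (THE A. A $ 0 = 1 \<and>
     (\<forall>n. A $ n \<in> generated_subalgebra {\<phi> s m | s m. True}) \<and>
     phi_series \<phi> e * (A * fps_dilate (q powi (2 * sign_int e)) A) =
       fps_const (\<phi> e 0) * normalized_poly_series e a)"

end

(*
  Write A for a solution of the equation defining the series at positive sign, t = q^-2, and let
  '' stand for the substitution of q^2 z for z.  Since 1 + q^(2n) never vanishes, the exchange
  relations of \<phi>(z) with the currents have a unique square root, which gives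
    [x_(n-1), A] = z (x_n A - t A x_n)   and   [A, y_(n-1)] = z (A y_n - t y_n A)
  with x = x^+ and y = x^-.  Put e = x_0 A - t A x_0, f = A y_1 - t y_1 A and let
  d = [e, y_0] + q^-1 k^-1 A, where k = \<phi>^+_0.  The matrix (A, f; e, d) behaves like the
  monodromy matrix of an integrable system: A'' d - z f'' e is its quantum determinant, and for any
  A satisfying the exchange relations this equals q^-1 A'' A \<phi>(z).

  The right-hand side of the theorem is R = A \<otimes> B + q z f \<otimes> e.  It satisfies the exchange
  relations with the images of the generators under \<Delta>: the case n = 0 is a direct computation,
  and the others follow by commuting with \<Delta>(h_1), which commutes with R.  The matrix attached to R
  is the product of the matrices of A and B, so its quantum determinant is the product of
  theirs.  Hence R solves the equation for \<Delta>(\<phi>(z)), whose solution is unique.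
  The formula at negative sign is the one at positive sign transported along the automorphism
  x^\<plusminus>_m \<mapsto> x^\<mp>_(-m), \<phi>^\<plusminus>_m \<mapsto> \<phi>^\<mp>_(-m), which flips the tensor factors of the coproduct.
*)

theory Submission
  imports Defs
begin

section \<open>Series over an algebra\<close>

instantiation fps :: (complex_algebra_1) complex_algebra_1
begin

definition scaleC_fps :: "complex \<Rightarrow> 'a fps \<Rightarrow> 'a fps"
  where "scaleC_fps c F = Abs_fps (\<lambda>n. c *\<^sub>C (F $ n))"

instance
  by standard
    (simp_all add: scaleC_fps_def fps_eq_iff fps_mult_nth scaleC_add_right scaleC_add_left
      scaleC_scaleC scaleC_one mult_scaleC_left mult_scaleC_right cvec.scale_sum_right)

end

lemma scaleC_fps_nth [simp]: "(c *\<^sub>C F) $ n = c *\<^sub>C (F $ n)"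
  by (simp add: scaleC_fps_def)

lemma fps_const_scaleC: "fps_const (c *\<^sub>C a) = c *\<^sub>C fps_const a"
  by (simp add: fps_eq_iff)

section \<open>Multiplication of a series by its indeterminate\<close>

definition zmul :: "'a::complex_algebra_1 fps \<Rightarrow> 'a fps" where
  "zmul F = fps_X * F"

lemma zmul_nth [simp]: "zmul F $ n = (if n = 0 then 0 else F $ (n - 1))"
  by (simp add: zmul_def)

lemma zmul_linear:
  "zmul (F + G) = zmul F + zmul G" "zmul (F - G) = zmul F - zmul G" "zmul (- F) = - zmul F"
  "zmul 0 = 0" "c *\<^sub>C zmul F = zmul (c *\<^sub>C F)"
  "zmul F * G = zmul (F * G)" "F * zmul G = zmul (F * G)"
proof -
  show "F * zmul G = zmul (F * G)"
    unfolding zmul_def by (metis mult.assoc fps_mult_fps_X_commute)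
  show "zmul F * G = zmul (F * G)"
    unfolding zmul_def by (simp add: mult.assoc)
  show "c *\<^sub>C zmul F = zmul (c *\<^sub>C F)"
    by (simp add: fps_eq_iff)
  show "zmul (F + G) = zmul F + zmul G" "zmul (F - G) = zmul F - zmul G" "zmul (- F) = - zmul F"
    "zmul 0 = 0"
    by (simp_all only: zmul_def distrib_left right_diff_distrib mult_minus_right mult_zero_right)
qed

lemma zmul_eq_iff: "zmul F = zmul G \<longleftrightarrow> F = G"
proof
  assume *: "zmul F = zmul G"
  have "F $ n = zmul F $ Suc n" "G $ n = zmul G $ Suc n" for n
    by simp_all
  with * show "F = G"
    by (metis fps_ext)
qed auto

lemma scaleC_linear:
  fixes a b :: "'a::complex_algebra_1"
  shows "c *\<^sub>C (a + b) = c *\<^sub>C a + c *\<^sub>C b" "c *\<^sub>C (a - b) = c *\<^sub>C a - c *\<^sub>C b"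
    "c *\<^sub>C (- a) = - (c *\<^sub>C a)" "c *\<^sub>C (0 :: 'a) = 0"
    "(c *\<^sub>C a) * b = c *\<^sub>C (a * b)" "a * (c *\<^sub>C b) = c *\<^sub>C (a * b)"
  by (simp_all add: scaleC_add_right cvec.scale_right_diff_distrib mult_scaleC_left
      mult_scaleC_right)

lemma scaleC_inverse_cancel:
  assumes "q \<noteq> 0"
  shows "q *\<^sub>C inverse q *\<^sub>C a = a" "inverse q *\<^sub>C q *\<^sub>C a = a"
  using assms by (simp_all add: scaleC_scaleC scaleC_one)

lemma mult_assoc_rule: "a * b = c \<Longrightarrow> a * (b * d) = c * (d :: 'a::semigroup_mult)"
  by (simp flip: mult.assoc)

lemmas expand = scaleC_linear zmul_linear distrib_left distrib_right
  left_diff_distrib right_diff_distrib mult.assoc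

text \<open>Each use of the hypothesis gains a factor z, so \<open>G n\<close> is divisible by every
  power of z. In the applications \<open>G n\<close> is the defect of an identity at index
  \<open>n\<close>, and this replaces summation over infinitely many modes.\<close>

lemma zmul_descent:
  assumes "\<And>n. G n = zmul (H n * G (Suc n))"
  shows "G n = 0"
proof -
  have "G n $ m = 0" for m n
  proof (induction m arbitrary: n rule: less_induct)
    case (less m)
    have "G n $ m = (if m = 0 then 0 else (H n * G (Suc n)) $ (m - 1))"
      by (subst assms) simp
    also have "\<dots> = 0"
      using less by (auto simp: fps_mult_nth intro!: sum.neutral)
    finally show ?case .
  qed
  then show ?thesis
    by (simp add: fps_eq_iff)
qed

section \<open>Substitution of c z for z\<close>

lemma fps_dilate_nth [simp]: "fps_dilate c F $ n = c ^ n *\<^sub>C (F $ n)"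
  by (simp add: fps_dilate_def)

lemma fps_dilate_linear:
  "fps_dilate c (F + G) = fps_dilate c F + fps_dilate c G"
  "fps_dilate c (F - G) = fps_dilate c F - fps_dilate c G"
  "fps_dilate c (d *\<^sub>C F) = d *\<^sub>C fps_dilate c F"
  "fps_dilate c (zmul F) = zmul (c *\<^sub>C fps_dilate c F)"
  "fps_dilate c (fps_const u) = fps_const u"
proof -
  show "fps_dilate c (zmul F) = zmul (c *\<^sub>C fps_dilate c F)"
  proof (rule fps_ext)
    fix n
    show "fps_dilate c (zmul F) $ n = zmul (c *\<^sub>C fps_dilate c F) $ n"
      by (cases n) (simp_all add: scaleC_scaleC)
  qed
  show "fps_dilate c (fps_const u) = fps_const u"
    by (rule fps_ext) (simp add: scaleC_one)
qed (simp_all add: fps_eq_iff scaleC_add_right cvec.scale_right_diff_distrib scaleC_scaleC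
    mult.commute)

lemma fps_dilate_mult: "fps_dilate c (F * G) = fps_dilate c F * fps_dilate c G"
proof (rule fps_ext)
  fix n
  have "c ^ n *\<^sub>C (F $ i * G $ (n - i)) = (c ^ i *\<^sub>C (F $ i)) * (c ^ (n - i) *\<^sub>C (G $ (n - i)))"
    if "i \<le> n" for i
    using that
    by (simp add: mult_scaleC_left mult_scaleC_right scaleC_scaleC flip: power_add)
  then show "fps_dilate c (F * G) $ n = (fps_dilate c F * fps_dilate c G) $ n"
    by (simp add: fps_mult_nth cvec.scale_sum_right)
qed

section \<open>Lowest coefficients and equations of Sylvester type\<close>

lemma mult_nth_lowest:
  fixes u a v :: "'a::complex_algebra_1 fps"
  assumes "\<And>i. i < n \<Longrightarrow> a $ i = 0"
  shows "(u * a) $ n = u $ 0 * a $ n" "(a * v) $ n = a $ n * v $ 0"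
    "i < n \<Longrightarrow> (u * a) $ i = 0" "i < n \<Longrightarrow> (a * v) $ i = 0"
proof -
  have "(u * a) $ n = (\<Sum>i\<in>{0}. u $ i * a $ (n - i))"
    unfolding fps_mult_nth by (rule sum.mono_neutral_right) (use assms in auto)
  then show "(u * a) $ n = u $ 0 * a $ n" by simp
  have "(a * v) $ n = (\<Sum>i\<in>{n}. a $ i * v $ (n - i))"
    unfolding fps_mult_nth by (rule sum.mono_neutral_right) (use assms in auto)
  then show "(a * v) $ n = a $ n * v $ 0" by simp
  show "i < n \<Longrightarrow> (u * a) $ i = 0" "i < n \<Longrightarrow> (a * v) $ i = 0"
    using assms by (auto simp: fps_mult_nth intro!: sum.neutral)
qed

text \<open>At the lowest degree n where D could be nonzero, the two products contribute c^n
  \<open>D $ n\<close> and \<open>D $ n\<close>, since U and V have constant term 1; then 1 + c^n is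
  cancelled.\<close>

lemma sylvester_zero_right:
  fixes U V D :: "'a::complex_algebra_1 fps"
  assumes "U $ 0 = 1" "V $ 0 = 1" "U * fps_dilate c D + D * V = 0" "\<And>n. 1 + c ^ n \<noteq> 0"
  shows "D = 0"
proof -
  have "D $ n = 0" for n
  proof (induction n rule: less_induct)
    case (less n)
    have "(D * V) $ n = D $ n"
      by (subst mult_nth_lowest(2)) (use less assms in \<open>auto simp: scaleC_one\<close>)
    moreover have "(U * fps_dilate c D) $ n = c ^ n *\<^sub>C (D $ n)"
      by (subst mult_nth_lowest(1)) (use less assms in auto)
    ultimately have "(1 + c ^ n) *\<^sub>C (D $ n) = 0"
      using arg_cong[OF assms(3), of "\<lambda>F. F $ n"]
      by (simp add: scaleC_add_left scaleC_one add.commute)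
    then show ?case using assms(4)[of n] by simp
  qed
  then show ?thesis by (simp add: fps_eq_iff)
qed

lemma sylvester_zero_left:
  fixes U V D :: "'a::complex_algebra_1 fps"
  assumes "U $ 0 = 1" "V $ 0 = 1" "U * D + fps_dilate c D * V = 0" "\<And>n. 1 + c ^ n \<noteq> 0"
  shows "D = 0"
proof -
  have "D $ n = 0" for n
  proof (induction n rule: less_induct)
    case (less n)
    have "(U * D) $ n = D $ n"
      by (subst mult_nth_lowest(1)) (use less assms in \<open>auto simp: scaleC_one\<close>)
    moreover have "(fps_dilate c D * V) $ n = c ^ n *\<^sub>C (D $ n)"
      by (subst mult_nth_lowest(2)) (use less assms in auto)
    ultimately have "(1 + c ^ n) *\<^sub>C (D $ n) = 0"
      using arg_cong[OF assms(3), of "\<lambda>F. F $ n"]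
      by (simp add: scaleC_add_left scaleC_one)
    then show ?case using assms(4)[of n] by simp
  qed
  then show ?thesis by (simp add: fps_eq_iff)
qed

text \<open>
  Equations between series whose coefficient of degree \<open>n\<close> involves the unknown coefficients
  of degree \<open>n\<close> only linearly are solved degree by degree.
\<close>

lemma triangular_equation_unique:
  fixes \<Phi> :: "'a::complex_algebra_1 fps \<Rightarrow> 'a fps"
  assumes lin: "\<And>F n. F $ 0 = a0 \<Longrightarrow> n > 0 \<Longrightarrow> \<Phi> F $ n = c n *\<^sub>C (F $ n) + \<Phi> (fps_cutoff n F) $ n"
    and c: "\<And>n. c n \<noteq> 0"
    and "F $ 0 = a0" "G $ 0 = a0" "\<Phi> F = \<Phi> G"
  shows "F = G"
proof -
  have "F $ n = G $ n" for n
  proof (induction n rule: less_induct)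
    case (less n)
    show ?case
    proof (cases "n = 0")
      case False
      have "fps_cutoff n F = fps_cutoff n G"
        using less by (simp add: fps_eq_iff)
      moreover have "c n *\<^sub>C (F $ n) + \<Phi> (fps_cutoff n F) $ n
          = c n *\<^sub>C (G $ n) + \<Phi> (fps_cutoff n G) $ n"
        using lin[of F n] lin[of G n] assms(3-5) False by simp
      ultimately show ?thesis using c[of n] by simp
    qed (use assms in simp)
  qed
  then show ?thesis by (simp add: fps_eq_iff)
qed

lemma triangular_equation_exists:
  fixes \<Phi> :: "'a::complex_algebra_1 fps \<Rightarrow> 'a fps"
  assumes lin: "\<And>F n. F $ 0 = a0 \<Longrightarrow> n > 0 \<Longrightarrow> \<Phi> F $ n = c n *\<^sub>C (F $ n) + \<Phi> (fps_cutoff n F) $ n"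
    and c: "\<And>n. c n \<noteq> 0"
    and base: "\<And>F. F $ 0 = a0 \<Longrightarrow> \<Phi> F $ 0 = M $ 0" "P a0"
    and step: "\<And>F n. (\<And>i. i < n \<Longrightarrow> P (F $ i)) \<Longrightarrow> n > 0 \<Longrightarrow>
      P (inverse (c n) *\<^sub>C (M $ n - \<Phi> (fps_cutoff n F) $ n))"
  shows "\<exists>F. F $ 0 = a0 \<and> \<Phi> F = M \<and> (\<forall>n. P (F $ n))"
proof -
  \<comment> \<open>The equation in degree n is solved for the coefficient of degree n.
    \<open>fps_cutoff n\<close> keeps only degrees below n, so the recursion is well
    founded.\<close>
  define g where "g = wfrec less_than (\<lambda>f n. if n = 0 then a0 else
    inverse (c n) *\<^sub>C (M $ n - \<Phi> (fps_cutoff n (Abs_fps f)) $ n))"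
  define F where "F = Abs_fps g"
  have F: "F $ n = (if n = 0 then a0 else
    inverse (c n) *\<^sub>C (M $ n - \<Phi> (fps_cutoff n F) $ n))" for n
  proof -
    have "fps_cutoff n (Abs_fps (cut g less_than n)) = fps_cutoff n (Abs_fps g)"
      by (simp add: fps_eq_iff cut_apply)
    then have "g n = (if n = 0 then a0 else
        inverse (c n) *\<^sub>C (M $ n - \<Phi> (fps_cutoff n (Abs_fps g)) $ n))"
      using wfrec[OF wf_less_than, of "\<lambda>f n. if n = 0 then a0 else
        inverse (c n) *\<^sub>C (M $ n - \<Phi> (fps_cutoff n (Abs_fps f)) $ n)" n]
      by (fold g_def) simp
    then show ?thesis by (simp add: F_def)
  qed
  have F0: "F $ 0 = a0" using F[of 0] by simp
  have "\<Phi> F $ n = M $ n" for n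
  proof (cases "n = 0")
    case False
    then have "\<Phi> F $ n = c n *\<^sub>C (F $ n) + \<Phi> (fps_cutoff n F) $ n"
      using lin[of F n] F0 by simp
    also have "c n *\<^sub>C (F $ n) = M $ n - \<Phi> (fps_cutoff n F) $ n"
      using F[of n] False c[of n] by (simp add: scaleC_scaleC scaleC_one)
    finally show ?thesis by simp
  qed (use base F0 in simp)
  moreover have "P (F $ n)" for n
  proof (induction n rule: less_induct)
    case (less n)
    then show ?case
      using F[of n] step[of n F] base by (cases "n = 0") auto
  qed
  ultimately show ?thesis using F0 by (auto simp: fps_eq_iff)
qed

text \<open>Split F into its truncation and a remainder starting in degree n. Up to degree n the
  product is linear in the remainder, which enters once directly and once dilated, hence the factor
  1 + c^n.\<close>

lemma dilation_square_triangular: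
  fixes P F :: "'a::complex_algebra_1 fps"
  assumes "P $ 0 = 1" "F $ 0 = 1" "n > 0"
  shows "(P * (F * fps_dilate c F)) $ n =
    (1 + c ^ n) *\<^sub>C (F $ n) + (P * (fps_cutoff n F * fps_dilate c (fps_cutoff n F))) $ n"
proof -
  define G where "G = fps_cutoff n F"
  define a where "a = F - G"
  have a: "\<And>i. i < n \<Longrightarrow> a $ i = 0" "a $ n = F $ n" and G0: "G $ 0 = 1" and a0: "a $ 0 = 0"
    using assms by (simp_all add: a_def G_def)
  have F: "F = G + a" by (simp add: a_def)
  have d: "\<And>i. i < n \<Longrightarrow> fps_dilate c a $ i = 0" using a by simp
  have "P * (F * fps_dilate c F) = P * (G * fps_dilate c G) + P * (a * fps_dilate c F)
    + P * (G * fps_dilate c a)"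
    by (simp add: F fps_dilate_linear algebra_simps)
  moreover have "(P * (a * fps_dilate c F)) $ n = F $ n"
    by (simp add: mult_nth_lowest a assms scaleC_one)
  moreover have "(P * (G * fps_dilate c a)) $ n = c ^ n *\<^sub>C (F $ n)"
    by (simp add: mult_nth_lowest d a assms G0)
  ultimately show ?thesis
    by (simp add: scaleC_add_left scaleC_one G_def)
qed

text \<open>F and G differ in degree n at the earliest; in a power with k >= 2 the difference is
  multiplied by series without constant term, which pushes it beyond degree n.\<close>

lemma power_diff_lowest:
  fixes F G :: "'a::complex_algebra_1 fps"
  assumes "F $ 0 = 0" "G $ 0 = 0" "\<And>i. i < n \<Longrightarrow> F $ i = G $ i" "n > 0" "k \<noteq> 1"
  shows "(F ^ k) $ n = (G ^ k) $ n"
proof -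
  have low: "(F ^ k - G ^ k) $ i = 0" if "i < n" for k i
    using that
  proof (induction k arbitrary: i)
    case (Suc k)
    have "F ^ Suc k - G ^ Suc k = F * (F ^ k - G ^ k) + (F - G) * G ^ k"
      by (simp add: algebra_simps)
    moreover have "(F * (F ^ k - G ^ k)) $ i = 0"
      by (rule mult_nth_lowest(3)[of n]) (use Suc in auto)
    moreover have "((F - G) * G ^ k) $ i = 0"
      by (rule mult_nth_lowest(4)[of n]) (use Suc assms in auto)
    ultimately show ?case by simp
  qed simp
  show ?thesis
  proof (cases k)
    case (Suc j)
    then have "j > 0" using assms by simp
    have "F ^ Suc j - G ^ Suc j = F * (F ^ j - G ^ j) + (F - G) * G ^ j"
      by (simp add: algebra_simps)
    moreover have "(F * (F ^ j - G ^ j)) $ n = 0"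
      by (subst mult_nth_lowest(1)) (use low assms in auto)
    moreover have "((F - G) * G ^ j) $ n = 0"
      by (subst mult_nth_lowest(2)) (use assms \<open>j > 0\<close> in \<open>auto simp: fps_nth_power_0 power_0_left\<close>)
    ultimately have "(F ^ Suc j - G ^ Suc j) $ n = 0" by simp
    then show ?thesis using Suc by simp
  qed simp
qed

lemma fps_scalar_mult: "fps_scalar c * F = c *\<^sub>C F"
  by (simp add: fps_eq_iff fps_scalar_def mult_scaleC_left)

text \<open>Only the first power of the argument sees its coefficient of degree n, so the
  exponential equation is triangular with the constant factor c.\<close>

lemma exponential_triangular:
  fixes F :: "'a::complex_algebra_1 fps"
  assumes "F $ 0 = 0" "n > 0"
  shows "fps_exponential (fps_scalar c * F) $ n =
    c *\<^sub>C (F $ n) + fps_exponential (fps_scalar c * fps_cutoff n F) $ n"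
proof -
  let ?f = "\<lambda>F k. (1 / fact k) *\<^sub>C (((c *\<^sub>C F) ^ k :: 'a fps) $ n)"
  have eq: "fps_exponential (fps_scalar c * F) $ n = (\<Sum>k\<in>{..n} - {1}. ?f F k) + c *\<^sub>C (F $ n)"
    for F :: "'a fps"
    using sum.remove[of "{..n}" 1 "?f F"] assms
    by (simp add: fps_exponential_def fps_scalar_mult scaleC_one add.commute)
  have "(\<Sum>k\<in>{..n} - {1}. ?f F k) = (\<Sum>k\<in>{..n} - {1}. ?f (fps_cutoff n F) k)"
    by (intro sum.cong refl arg_cong[where f = "\<lambda>u. _ *\<^sub>C u"] power_diff_lowest)
      (use assms in auto)
  then show ?thesis by (simp add: eq)
qed

section \<open>Exchange relations\<close>

text \<open>
  Scalars are kept as unmerged iterated scalings by \<open>q\<close>, \<open>inverse q\<close> and \<open>r\<close>: this gives the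
  terms produced by \<open>expand\<close> a normal form, on which the identities below become linear.
\<close>

declare cvec.scale_scale [simp del]

definition qbracket :: "complex \<Rightarrow> 'a::complex_algebra_1 \<Rightarrow> 'a \<Rightarrow> 'a" where
  "qbracket q a b = a * b - inverse q *\<^sub>C inverse q *\<^sub>C (b * a)"

abbreviation (input) qdilate :: "complex \<Rightarrow> 'a::complex_algebra_1 fps \<Rightarrow> 'a fps" where
  "qdilate q \<equiv> fps_dilate (q * q)"

text \<open>The exchange relations are isolated so that they apply to A and also, with the images of
  the currents under \<Delta>, to the candidate R for the coproduct.\<close>

locale current_pair =
  fixes q :: complex and X Y :: "nat \<Rightarrow> 'a::complex_algebra_1 fps" and A :: "'a fps"
  assumes q_nonzero: "q \<noteq> 0"
    and X_A: "X n * A = A * X n + zmul (qbracket q (X (Suc n)) A)"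
    and A_Y: "A * Y n = Y n * A + zmul (qbracket q A (Y (Suc n)))"
begin

definition e :: "nat \<Rightarrow> 'a fps" where "e n = qbracket q (X (Suc n)) A"

definition f :: "nat \<Rightarrow> 'a fps" where "f n = qbracket q A (Y (Suc n))"

lemmas q_cancel = scaleC_inverse_cancel[OF q_nonzero]

lemmas X_A' = X_A[unfolded qbracket_def]
lemmas A_Y' = A_Y[unfolded qbracket_def]

text \<open>\<open>S n\<close> is the half current \<open>X (n+1) + z X (n+2) + ...\<close>, so e is
  A times a half current up to the scalar 1 - q^-2. The defect at n is z times the defect at n +
  1.\<close>

lemma e_eq_series:
  assumes "\<And>n. S n = X (Suc n) + zmul (S (Suc n))"
  shows "e n = A * S n - inverse q *\<^sub>C inverse q *\<^sub>C (A * S n)"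
proof -
  define G where "G n = e n - (A * S n - inverse q *\<^sub>C inverse q *\<^sub>C (A * S n))" for n
  have "G n = zmul (1 * G (Suc n))" for n
    by (simp add: G_def e_def qbracket_def assms[of n] X_A'[of "Suc n"] expand)
  then have "G n = 0" by (rule zmul_descent)
  then show ?thesis by (simp add: G_def)
qed

text \<open>Again the defect at n is z times the defect at n + 1. The identity is what lets f'' pass
  A in the quantum determinant.\<close>

lemma dilate_A_f:
  assumes "\<And>n. qdilate q (Y n) = Y n"
  shows "qdilate q A * f n = qdilate q (f n) * A"
proof -
  define B where "B = qdilate q A"
  have B_Y: "B * Y n = Y n * B + zmul (q *\<^sub>C q *\<^sub>C (B * Y (Suc n)) - Y (Suc n) * B)" for n
    using arg_cong[OF A_Y[of n], of "qdilate q"] assms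
    by (simp add: B_def fps_dilate_linear fps_dilate_mult qbracket_def expand q_cancel
        flip: scaleC_scaleC)
  have f: "qdilate q (f n) = B * Y (Suc n) - inverse q *\<^sub>C inverse q *\<^sub>C (Y (Suc n) * B)" for n
    using assms by (simp add: f_def qbracket_def B_def fps_dilate_linear fps_dilate_mult)
  define G where "G n = B * f n - qdilate q (f n) * A" for n
  have "G n = zmul (1 * G (Suc n))" for n
    unfolding G_def f unfolding f_def
    by (simp add: qbracket_def expand q_cancel A_Y'[of "Suc n"] B_Y[of "Suc n"]
        mult_assoc_rule[OF A_Y'[of "Suc n"]] mult_assoc_rule[OF B_Y[of "Suc n"]])
  then have "G n = 0" by (rule zmul_descent)
  then show ?thesis by (simp add: G_def B_def)
qed

text \<open>Up to a scalar, the q-commutation defect at n is z times the commutation defect, which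
  is z times the q-commutation defect at n + 1; the descent gains two degrees per step.\<close>

lemma X_e:
  assumes "\<And>n. X n * X (Suc n) = inverse q *\<^sub>C inverse q *\<^sub>C (X (Suc n) * X n)"
  shows "X n * e n = inverse q *\<^sub>C inverse q *\<^sub>C (e n * X n)" "X (Suc n) * e n = e n * X (Suc n)"
proof -
  define G where "G n = X n * e n - inverse q *\<^sub>C inverse q *\<^sub>C (e n * X n)" for n
  have 1: "G n = zmul (inverse q *\<^sub>C inverse q *\<^sub>C (X (Suc n) * e n - e n * X (Suc n)))" for n
    unfolding G_def e_def qbracket_def
    by (simp add: expand q_cancel X_A'[of n] assms[of n]
        mult_assoc_rule[OF X_A'[of n]] mult_assoc_rule[OF assms[of n]])
  have 2: "X (Suc n) * e n - e n * X (Suc n) = zmul (G (Suc n))" for n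
    unfolding G_def e_def qbracket_def
    by (simp add: expand q_cancel X_A'[of "Suc n"] assms[of "Suc n"]
        mult_assoc_rule[OF X_A'[of "Suc n"]] mult_assoc_rule[OF assms[of "Suc n"]])
  have "G n = zmul (zmul (inverse q *\<^sub>C inverse q *\<^sub>C 1) * G (Suc n))" for n
    unfolding 1[of n] 2[of n] by (simp add: expand)
  then have G: "G n = 0" for n by (rule zmul_descent)
  show "X n * e n = inverse q *\<^sub>C inverse q *\<^sub>C (e n * X n)"
    using G[of n] by (simp add: G_def)
  show "X (Suc n) * e n = e n * X (Suc n)"
    using 2[of n] G[of "Suc n"] by (simp add: zmul_linear)
qed

lemma f_Y:
  assumes "\<And>n. Y (Suc n) * Y n = inverse q *\<^sub>C inverse q *\<^sub>C (Y n * Y (Suc n))"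
  shows "f n * Y n = inverse q *\<^sub>C inverse q *\<^sub>C (Y n * f n)" "f n * Y (Suc n) = Y (Suc n) * f n"
proof -
  define G where "G n = f n * Y n - inverse q *\<^sub>C inverse q *\<^sub>C (Y n * f n)" for n
  have 1: "G n = zmul (inverse q *\<^sub>C inverse q *\<^sub>C (f n * Y (Suc n) - Y (Suc n) * f n))" for n
    unfolding G_def f_def qbracket_def
    by (simp add: expand q_cancel A_Y'[of n] assms[of n]
        mult_assoc_rule[OF A_Y'[of n]] mult_assoc_rule[OF assms[of n]])
  have 2: "f n * Y (Suc n) - Y (Suc n) * f n = zmul (G (Suc n))" for n
    unfolding G_def f_def qbracket_def
    by (simp add: expand q_cancel A_Y'[of "Suc n"] assms[of "Suc n"]
        mult_assoc_rule[OF A_Y'[of "Suc n"]] mult_assoc_rule[OF assms[of "Suc n"]])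
  have "G n = zmul (zmul (inverse q *\<^sub>C inverse q *\<^sub>C 1) * G (Suc n))" for n
    unfolding 1[of n] 2[of n] by (simp add: expand)
  then have G: "G n = 0" for n by (rule zmul_descent)
  show "f n * Y n = inverse q *\<^sub>C inverse q *\<^sub>C (Y n * f n)"
    using G[of n] by (simp add: G_def)
  show "f n * Y (Suc n) = Y (Suc n) * f n"
    using 2[of n] G[of "Suc n"] by (simp add: zmul_linear)
qed

text \<open>\<open>\<Phi>\<close> stands for \<phi>^+(z) and \<open>k'\<close> for \<phi>^-_0. The
  factor next to A'' is d, spelled out as a commutator so that the identity also applies to R. Since
  e is A times a half current and f'' A = A'' f, both terms have A'' as a left factor.\<close>

lemma quantum_determinant:
  assumes S: "\<And>n. S n = X (Suc n) + zmul (S (Suc n))"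
    and Y: "\<And>n. qdilate q (Y n) = Y n"
    and \<Phi>: "q *\<^sub>C (S 0 * Y 0 - Y 0 * S 0) - inverse q *\<^sub>C (S 0 * Y 0 - Y 0 * S 0) = \<Phi> - k'"
  shows "qdilate q A * (e 0 * Y 0 - Y 0 * e 0 + inverse q *\<^sub>C (A * k')) -
      zmul (qdilate q (f 0) * e 0) = inverse q *\<^sub>C (qdilate q A * A * \<Phi>)"
proof -
  have \<Phi>': "\<Phi> = k' + (q *\<^sub>C (S 0 * Y 0 - Y 0 * S 0) - inverse q *\<^sub>C (S 0 * Y 0 - Y 0 * S 0))"
    using \<Phi> by (simp add: algebra_simps)
  have e: "e 0 = A * S 0 - inverse q *\<^sub>C inverse q *\<^sub>C (A * S 0)"
    using S by (rule e_eq_series)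
  have "qdilate q (f 0) * e 0 = qdilate q A * f 0 * S 0
      - inverse q *\<^sub>C inverse q *\<^sub>C (qdilate q A * f 0 * S 0)"
    by (simp add: e dilate_A_f[OF Y] expand mult_assoc_rule[OF dilate_A_f[OF Y]])
  moreover have "A * (Y 0 * w) = Y 0 * (A * w) + zmul (f 0 * w)" for w
    using mult_assoc_rule[OF A_Y[of 0]] by (simp add: f_def expand)
  ultimately show ?thesis
    by (simp add: e \<Phi>' expand q_cancel)
qed

end

text \<open>The relations between low modes on which the matrix calculus rests: \<open>k\<close>,
  \<open>k'\<close>, \<open>\<phi>m\<close>, \<open>g\<close> and \<open>r\<close> stand for
  \<phi>^+_0, \<phi>^-_0, \<phi>^-_{-1}, r \<phi>^+_1 and 1 / (q - q^-1).\<close>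

locale lax = current_pair +
  fixes k k' \<phi>m g :: "'a fps" and r :: complex
  assumes q_r: "q * r - inverse q * r = 1"
    and A_k: "A * k = k * A" "A * k' = k' * A" "A * \<phi>m = \<phi>m * A" "A * g = g * A"
    and X_Y: "X 0 * Y 0 = Y 0 * X 0 - r *\<^sub>C \<phi>m"
      "X 1 * Y 0 = Y 0 * X 1 + r *\<^sub>C k - r *\<^sub>C k'"
      "X 0 * Y 1 = Y 1 * X 0 + r *\<^sub>C k - r *\<^sub>C k'"
      "X 1 * Y 1 = Y 1 * X 1 + g"
    and k_k': "k * k' = 1" "k' * k = 1"
    and X_X: "\<And>n. X n * X (Suc n) = inverse q *\<^sub>C inverse q *\<^sub>C (X (Suc n) * X n)"
    and Y_Y: "\<And>n. Y (Suc n) * Y n = inverse q *\<^sub>C inverse q *\<^sub>C (Y n * Y (Suc n))"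
    and X_k: "\<And>n. X n * k = inverse q *\<^sub>C inverse q *\<^sub>C (k * X n)"
    and Y_k: "\<And>n. Y n * k = q *\<^sub>C q *\<^sub>C (k * Y n)"
    and Y_\<phi>: "Y 1 * \<phi>m = inverse q *\<^sub>C inverse q *\<^sub>C (\<phi>m * Y 1)
        - k' * Y 0 + inverse q *\<^sub>C inverse q *\<^sub>C inverse q *\<^sub>C inverse q *\<^sub>C (k' * Y 0)"
    and X_\<phi>: "X 1 * \<phi>m = q *\<^sub>C q *\<^sub>C (\<phi>m * X 1)
        + q *\<^sub>C q *\<^sub>C q *\<^sub>C q *\<^sub>C (k' * X 0) - k' * X 0"
    and dilate_X: "\<And>n. qdilate q (X n) = X n"
    and dilate_Y: "\<And>n. qdilate q (Y n) = Y n"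
    and dilate_k: "qdilate q k = k" "qdilate q k' = k'"
begin

text \<open>Consequences of (q - q^-1) r = 1, oriented so that scalars containing r reach a normal
  form too.\<close>

lemma r_reduce:
  "inverse q *\<^sub>C inverse q *\<^sub>C r *\<^sub>C (a::'b::complex_algebra_1) = r *\<^sub>C a - inverse q *\<^sub>C a"
  "q *\<^sub>C r *\<^sub>C a = a + inverse q *\<^sub>C r *\<^sub>C a"
proof -
  have "inverse q * (inverse q * r) = r - inverse q"
  proof -
    have "inverse q * (inverse q * r) = r - inverse q * (q * r - inverse q * r)"
      using q_nonzero by (simp add: field_simps)
    then show ?thesis by (simp add: q_r)
  qed
  then show "inverse q *\<^sub>C inverse q *\<^sub>C r *\<^sub>C a = r *\<^sub>C a - inverse q *\<^sub>C a"
    by (simp add: scaleC_scaleC cvec.scale_left_diff_distrib)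
  have "q * r = 1 + inverse q * r" using q_r by (simp add: algebra_simps)
  then show "q *\<^sub>C r *\<^sub>C a = a + inverse q *\<^sub>C r *\<^sub>C a"
    by (simp add: scaleC_scaleC scaleC_add_left scaleC_one)
qed

lemma r_move: "r *\<^sub>C q *\<^sub>C (a::'b::complex_algebra_1) = q *\<^sub>C r *\<^sub>C a"
   "r *\<^sub>C inverse q *\<^sub>C a = inverse q *\<^sub>C r *\<^sub>C a"
  by (simp_all add: scaleC_scaleC mult.commute)

lemmas scalars = q_cancel r_reduce r_move

text \<open>The fourth matrix entry, in the form met when \<open>X 1\<close> moves past f. The next
  lemmas rewrite it through [e, \<open>Y 0\<close>], through [\<open>X 0\<close>, f] and through the
  q-bracket of e with \<open>Y 1\<close>; all four forms are needed.\<close>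

definition d :: "'a fps" where
  "d = zmul (qbracket q (X 1) (f 0)) + inverse q *\<^sub>C (k * A)"

lemma e_Y_commutator: "e 0 * Y 0 - Y 0 * e 0 = d - inverse q *\<^sub>C (k' * A)"
  by (simp add: d_def e_def f_def qbracket_def expand scalars A_Y'[of 0] X_Y[simplified]
      mult_assoc_rule[OF A_Y'[of 0]] X_Y[THEN mult_assoc_rule, simplified] A_k A_k[THEN mult_assoc_rule])

lemma X_f_commutator: "X 0 * f 0 - f 0 * X 0 = d - inverse q *\<^sub>C (k' * A)"
  by (simp add: d_def f_def qbracket_def expand scalars X_A'[of 0] X_Y[simplified]
      mult_assoc_rule[OF X_A'[of 0]] X_Y[THEN mult_assoc_rule, simplified] A_k A_k[THEN mult_assoc_rule])

lemma d_eq: "d = inverse q *\<^sub>C (k * A) + zmul (qbracket q (e 0) (Y 1))"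
  by (simp add: d_def e_def f_def qbracket_def expand scalars X_Y[simplified]
      X_Y[THEN mult_assoc_rule, simplified] A_k A_k[THEN mult_assoc_rule])

lemma k'_relations:
  "X n * k' = q *\<^sub>C q *\<^sub>C (k' * X n)" "Y n * k' = inverse q *\<^sub>C inverse q *\<^sub>C (k' * Y n)"
proof -
  have X: "k * X n = q *\<^sub>C q *\<^sub>C (X n * k)" and Y: "k * Y n = inverse q *\<^sub>C inverse q *\<^sub>C (Y n * k)"
    by (simp_all add: X_k Y_k q_cancel)
  have "k' * (k * X n) * k' = q *\<^sub>C q *\<^sub>C (k' * X n * (k * k'))"
    unfolding X by (simp add: expand)
  then show "X n * k' = q *\<^sub>C q *\<^sub>C (k' * X n)"
    using k_k' by (metis mult.assoc mult_1 mult_1_right)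
  have "k' * (k * Y n) * k' = inverse q *\<^sub>C inverse q *\<^sub>C (k' * Y n * (k * k'))"
    unfolding Y by (simp add: expand)
  then show "Y n * k' = inverse q *\<^sub>C inverse q *\<^sub>C (k' * Y n)"
    using k_k' by (metis mult.assoc mult_1 mult_1_right)
qed

lemmas move_k = A_k A_k[THEN mult_assoc_rule] X_k Y_k k'_relations
  X_k[THEN mult_assoc_rule] Y_k[THEN mult_assoc_rule] k'_relations[THEN mult_assoc_rule]
  Y_\<phi>[simplified] X_\<phi>[simplified] Y_\<phi>[THEN mult_assoc_rule, simplified]
  X_\<phi>[THEN mult_assoc_rule, simplified]

text \<open>f q-commutes with \<open>Y 0\<close>, so once d is written through
  [\<open>X 0\<close>, f] only [\<open>X 0\<close>, \<open>Y 0\<close>], a multiple of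
  \<phi>^-_{-1}, survives. Moving it past f and cancelling against the term with k' leaves the
  right-hand side.\<close>

lemma d_Y: "d * Y 0 - inverse q *\<^sub>C inverse q *\<^sub>C (Y 0 * d) = - zmul (inverse q *\<^sub>C (f 0 * k'))"
proof -
  have d: "d = X 0 * f 0 - f 0 * X 0 + inverse q *\<^sub>C (k' * A)"
    by (simp add: X_f_commutator)
  have "d * Y 0 - inverse q *\<^sub>C inverse q *\<^sub>C (Y 0 * d) = r *\<^sub>C (f 0 * \<phi>m)
      - r *\<^sub>C inverse q *\<^sub>C inverse q *\<^sub>C (\<phi>m * f 0)
      + inverse q *\<^sub>C (k' * A * Y 0 - inverse q *\<^sub>C inverse q *\<^sub>C (Y 0 * k' * A))"
    unfolding d
    by (simp add: expand scalars f_Y[OF Y_Y] mult_assoc_rule[OF f_Y(1)[OF Y_Y]] X_Y(1)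
        mult_assoc_rule[OF X_Y(1)])
  also have "\<dots> = - zmul (inverse q *\<^sub>C (f 0 * k'))"
    by (simp add: f_def qbracket_def expand scalars move_k A_Y'[of 0])
  finally show ?thesis .
qed

text \<open>The mirror argument: d is written through [e, \<open>Y 0\<close>], and e q-commutes with
  \<open>X 0\<close>.\<close>

lemma X_d: "X 0 * d - inverse q *\<^sub>C inverse q *\<^sub>C (d * X 0) = - zmul (inverse q *\<^sub>C (k' * e 0))"
proof -
  have d: "d = e 0 * Y 0 - Y 0 * e 0 + inverse q *\<^sub>C (k' * A)"
    by (simp add: e_Y_commutator)
  have "X 0 * d - inverse q *\<^sub>C inverse q *\<^sub>C (d * X 0) = r *\<^sub>C (\<phi>m * e 0)
      - r *\<^sub>C inverse q *\<^sub>C inverse q *\<^sub>C (e 0 * \<phi>m)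
      + inverse q *\<^sub>C (X 0 * k' * A - inverse q *\<^sub>C inverse q *\<^sub>C (k' * A * X 0))"
    unfolding d
    by (simp add: expand scalars X_e[OF X_X] mult_assoc_rule[OF X_e(1)[OF X_X]] X_Y(1)
        mult_assoc_rule[OF X_Y(1)])
  also have "\<dots> = - zmul (inverse q *\<^sub>C (k' * e 0))"
    by (simp add: e_def qbracket_def expand scalars move_k X_A'[of 0])
  finally show ?thesis .
qed

section \<open>Further identities around the quantum determinant\<close>

lemma dilated_relations:
  "X 0 * qdilate q A = qdilate q A * X 0 + zmul (q *\<^sub>C q *\<^sub>C qdilate q (e 0))"
  "X 0 * qdilate q (f 0) = qdilate q (f 0) * X 0 + qdilate q d - inverse q *\<^sub>C (k' * qdilate q A)"
  "qdilate q A * k' = k' * qdilate q A"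
proof -
  have "X 0 * f 0 = f 0 * X 0 + (d - inverse q *\<^sub>C (k' * A))"
    by (simp flip: X_f_commutator)
  from arg_cong[OF this, of "qdilate q"]
  show "X 0 * qdilate q (f 0) = qdilate q (f 0) * X 0 + qdilate q d
      - inverse q *\<^sub>C (k' * qdilate q A)"
    by (simp add: fps_dilate_linear fps_dilate_mult dilate_X dilate_k)
  show "X 0 * qdilate q A = qdilate q A * X 0 + zmul (q *\<^sub>C q *\<^sub>C qdilate q (e 0))"
    using arg_cong[OF X_A[of 0], of "qdilate q"]
    by (simp add: fps_dilate_linear fps_dilate_mult dilate_X e_def scaleC_scaleC)
  show "qdilate q A * k' = k' * qdilate q A"
    using arg_cong[OF A_k(2), of "qdilate q"] by (simp add: fps_dilate_mult dilate_k)
qed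

text \<open>Taking the commutator of \<open>X 0\<close> with A'' f = f'' A turns A into z e, and f
  into d up to a multiple of k' A. The terms with k' cancel, and a second expression for the
  determinant remains.\<close>

lemma dual_determinant:
  "qdilate q A * d - zmul (qdilate q (f 0) * e 0) =
   qdilate q d * A - zmul (q *\<^sub>C q *\<^sub>C (qdilate q (e 0) * f 0))"
proof -
  have X_f: "X 0 * f 0 = f 0 * X 0 + d - inverse q *\<^sub>C (k' * A)"
    using X_f_commutator by (simp add: algebra_simps)
  have X_A: "X 0 * A = A * X 0 + zmul (e 0)"
    by (simp add: X_A[of 0] e_def)
  have "X 0 * (qdilate q A * f 0) - (qdilate q A * f 0) * X 0 =
      X 0 * (qdilate q (f 0) * A) - (qdilate q (f 0) * A) * X 0"
    by (simp add: dilate_A_f[OF dilate_Y])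
  then show ?thesis
    by (simp add: expand dilated_relations mult_assoc_rule[OF dilated_relations(1)]
       mult_assoc_rule[OF dilated_relations(2)] mult_assoc_rule[OF dilated_relations(3)] X_f X_A)
      (simp add: algebra_simps)
qed

text \<open>The determinant is k times a central series, so \<open>X 0\<close> passes it with the
  factor q^-2. Moving \<open>X 0\<close> through the expanded determinant and comparing leaves z
  times the claim.\<close>

lemma dilate_e_d:
  assumes "qdilate q A * d - zmul (qdilate q (f 0) * e 0) = k * N" "\<And>w. N * w = w * N"
  shows "q *\<^sub>C q *\<^sub>C (qdilate q (e 0) * d) = qdilate q d * e 0"
proof -
  define Q where "Q = k * N"
  have "X 0 * Q = inverse q *\<^sub>C inverse q *\<^sub>C (k * (X 0 * N))"
    unfolding Q_def by (simp add: mult_assoc_rule[OF X_k] expand)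
  then have "X 0 * Q = inverse q *\<^sub>C inverse q *\<^sub>C (Q * X 0)"
    unfolding Q_def by (simp add: mult.assoc assms(2))
  then have "X 0 * (qdilate q A * d - zmul (qdilate q (f 0) * e 0)) =
      inverse q *\<^sub>C inverse q *\<^sub>C ((qdilate q A * d - zmul (qdilate q (f 0) * e 0)) * X 0)"
    unfolding Q_def assms(1) .
  moreover have X_d': "X 0 * d = inverse q *\<^sub>C inverse q *\<^sub>C (d * X 0)
      - zmul (inverse q *\<^sub>C (k' * e 0))"
    using X_d by (simp add: algebra_simps)
  ultimately have "zmul (q *\<^sub>C q *\<^sub>C (qdilate q (e 0) * d)) = zmul (qdilate q d * e 0)"
    by (simp add: expand dilated_relations mult_assoc_rule[OF dilated_relations(1)] X_e(1)[OF X_X]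
       mult_assoc_rule[OF dilated_relations(2)] mult_assoc_rule[OF dilated_relations(3)] X_d')
  then show ?thesis by (simp add: zmul_eq_iff)
qed

end

section \<open>Tensor products of exchange relations\<close>

text \<open>\<open>XV\<close>, \<open>YV\<close> and \<open>H\<close> are to be the images under
  \<Delta> of the currents and of \<open>h\<close> = (q - q^-1) h_1. Keeping \<open>tens\<close>
  abstract lets the same calculation serve the flipped tensor product.\<close>

locale lax_tensor =
  A: lax q X Y A k k' \<phi>m g r + B: lax q X Y B k k' \<phi>m g r
  for q :: complex and X Y :: "nat \<Rightarrow> 'a::complex_algebra_1 fps" and A B k k' \<phi>m g r +
  fixes tens :: "'a fps \<Rightarrow> 'a fps \<Rightarrow> 'b::complex_algebra_1 fps"
    and XV YV :: "nat \<Rightarrow> 'b fps" and H :: "'b fps" and h :: "'a fps"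
  assumes tens_add: "tens (F + F') G = tens F G + tens F' G" "tens F (G + G') = tens F G +
      tens F G'"
    and tens_scale: "tens (c *\<^sub>C F) G = c *\<^sub>C tens F G" "tens F (c *\<^sub>C G) = c *\<^sub>C tens F G"
    and tens_zmul: "tens (zmul F) G = zmul (tens F G)" "tens F (zmul G) = zmul (tens F G)"
    and tens_mult: "tens F G * tens F' G' = tens (F * F') (G * G')"
    and tens_dilate: "qdilate q (tens F G) = tens (qdilate q F) (qdilate q G)"
    and XV: "XV 0 = tens (X 0) 1 + tens k' (X 0)" "XV 1 = tens (X 1) 1 + tens k (X 1)"
    and YV: "YV 0 = tens 1 (Y 0) + tens (Y 0) k'" "YV 1 = tens 1 (Y 1) + tens (Y 1) k"
    and h_A: "h * A = A * h" "h * B = B * h"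
    and h_X: "\<And>n. h * X n = X n * h + (q * q - inverse q * inverse q) *\<^sub>C X (Suc n)"
    and h_Y: "\<And>n. h * Y n = Y n * h - (q * q - inverse q * inverse q) *\<^sub>C Y (Suc n)"
    and H: "H = tens h 1 + tens 1 h
      - ((q - inverse q) * (q * q - inverse q * inverse q)) *\<^sub>C tens (Y 1) (X 1)"
    and H_XV: "\<And>n. H * XV n = XV n * H + (q * q - inverse q * inverse q) *\<^sub>C XV (Suc n)"
    and H_YV: "\<And>n. H * YV n = YV n * H - (q * q - inverse q * inverse q) *\<^sub>C YV (Suc n)"
    and q_fourth: "q * q - inverse q * inverse q \<noteq> 0"
begin

lemma tens_diff: "tens (F - F') G = tens F G - tens F' G" "tens F (G - G') = tens F G - tens F G'"
  by (metis add_diff_cancel diff_add_cancel tens_add)+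

lemma tens_zero: "tens 0 G = 0" "tens F 0 = 0"
  using tens_diff(1)[of 0 0] tens_diff(2)[of _ 0 0] by simp_all

lemma tens_minus: "tens (- F) G = - tens F G" "tens F (- G) = - tens F G"
  using tens_diff(1)[of 0 F] tens_diff(2)[of _ 0 G] by (simp_all add: tens_zero)

lemmas tens_linear = tens_add tens_diff tens_scale tens_zmul tens_zero tens_minus tens_mult

definition R :: "'b fps" where
  "R = tens A B + zmul (q *\<^sub>C tens (A.f 0) (B.e 0))"

section \<open>Exchange relations for the product R\<close>

lemma XV_0_R:
  "XV 0 * R = R * XV 0 + zmul (tens (A.e 0) B + q *\<^sub>C tens A.d (B.e 0))"
proof -
  have f_k': "A.f 0 * k' = inverse q *\<^sub>C inverse q *\<^sub>C (k' * A.f 0)"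
    by (simp add: A.f_def qbracket_def expand A.move_k A.scalars)
  have X_A: "X 0 * A = A * X 0 + zmul (A.e 0)"
    by (simp add: A.X_A[of 0] A.e_def)
  have X_B: "X 0 * B = B * X 0 + zmul (B.e 0)"
    by (simp add: B.X_A[of 0] B.e_def)
  have X_f: "X 0 * A.f 0 = A.f 0 * X 0 + A.d - inverse q *\<^sub>C (k' * A)"
    using A.X_f_commutator by (simp add: algebra_simps)
  show ?thesis
    by (simp add: R_def XV expand tens_linear X_A X_B X_f B.X_e[OF B.X_X] f_k' A.A_k A.scalars)
qed

text \<open>The right-hand side is the lower left entry of the product of the matrices of A and B.
  Together with \<open>XV_0_R\<close> it gives the exchange relation at n = 0.\<close>

lemma e_R: "qbracket q (XV 1) R = tens (A.e 0) B + q *\<^sub>C tens A.d (B.e 0)"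
proof -
  have f_k: "A.f 0 * k = q *\<^sub>C q *\<^sub>C (k * A.f 0)"
    by (simp add: A.f_def qbracket_def expand A.move_k A.scalars)
  define w where "w = qbracket q (X 1) (A.f 0)"
  have d: "A.d = zmul w + inverse q *\<^sub>C (k * A)"
    by (simp add: A.d_def w_def)
  have X_f: "X (Suc 0) * A.f 0 = w + inverse q *\<^sub>C inverse q *\<^sub>C (A.f 0 * X (Suc 0))"
    by (simp add: w_def qbracket_def)
  have X_A: "X (Suc 0) * A = A.e 0 + inverse q *\<^sub>C inverse q *\<^sub>C (A * X (Suc 0))"
    by (simp add: A.e_def qbracket_def)
  have X_B: "X (Suc 0) * B = B.e 0 + inverse q *\<^sub>C inverse q *\<^sub>C (B * X (Suc 0))"
    by (simp add: B.e_def qbracket_def)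
  show ?thesis
    unfolding XV R_def qbracket_def
    by (simp add: d expand tens_linear X_A X_B X_f B.X_e[OF B.X_X] f_k A.A_k A.scalars)
qed

lemma R_YV_0:
  "R * YV 0 = YV 0 * R + zmul (tens A (B.f 0) + q *\<^sub>C tens (A.f 0) B.d)"
proof -
  have e_k': "B.e 0 * k' = q *\<^sub>C q *\<^sub>C (k' * B.e 0)"
    by (simp add: B.e_def qbracket_def expand B.move_k B.scalars)
  have A_Y: "A * Y 0 = Y 0 * A + zmul (A.f 0)"
    by (simp add: A.A_Y[of 0] A.f_def)
  have B_Y: "B * Y 0 = Y 0 * B + zmul (B.f 0)"
    by (simp add: B.A_Y[of 0] B.f_def)
  have e_Y: "B.e 0 * Y 0 = Y 0 * B.e 0 + B.d - inverse q *\<^sub>C (k' * B)"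
    using B.e_Y_commutator by (simp add: algebra_simps)
  show ?thesis
    by (simp add: R_def YV expand tens_linear A_Y B_Y e_Y A.f_Y[OF A.Y_Y] e_k' B.A_k A.scalars)
qed

lemma f_R: "qbracket q R (YV 1) = tens A (B.f 0) + q *\<^sub>C tens (A.f 0) B.d"
proof -
  have e_k: "B.e 0 * k = inverse q *\<^sub>C inverse q *\<^sub>C (k * B.e 0)"
    by (simp add: B.e_def qbracket_def expand B.move_k B.scalars)
  define w where "w = qbracket q (B.e 0) (Y 1)"
  have d: "B.d = zmul w + inverse q *\<^sub>C (k * B)"
    by (simp add: B.d_eq w_def)
  have e_Y: "B.e 0 * Y (Suc 0) = w + inverse q *\<^sub>C inverse q *\<^sub>C (Y (Suc 0) * B.e 0)"
    by (simp add: w_def qbracket_def)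
  have A_Y: "A * Y (Suc 0) = A.f 0 + inverse q *\<^sub>C inverse q *\<^sub>C (Y (Suc 0) * A)"
    by (simp add: A.f_def qbracket_def)
  have B_Y: "B * Y (Suc 0) = B.f 0 + inverse q *\<^sub>C inverse q *\<^sub>C (Y (Suc 0) * B)"
    by (simp add: B.f_def qbracket_def)
  show ?thesis
    unfolding YV R_def qbracket_def
    by (simp add: d expand tens_linear A_Y B_Y e_Y A.f_Y[OF A.Y_Y] e_k B.A_k A.scalars)
qed

text \<open>As z f = [A, \<open>Y 0\<close>], z e = [\<open>X 0\<close>, B] and h raises modes, the
  commutators of h \<otimes> 1 and 1 \<otimes> h with z f \<otimes> e are explicit. They cancel
  against the commutator of the correction term in H with A \<otimes> B.\<close>

lemma H_R: "H * R = R * H"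
proof -
  define c where "c = q * q - inverse q * inverse q"
  define s where "s = (q - inverse q) * c"
  let ?fe = "tens (A.f 0) (B.e 0)"
  have zf: "zmul (A.f 0) = A * Y 0 - Y 0 * A"
    by (simp add: A.A_Y[of 0] A.f_def)
  have ze: "zmul (B.e 0) = X 0 * B - B * X 0"
    by (simp add: B.X_A[of 0] B.e_def)
  note h_AB = h_A h_A[THEN mult_assoc_rule]
  have "h * zmul (A.f 0) - zmul (A.f 0) * h = - (c *\<^sub>C (A * Y 1 - Y 1 * A))"
    unfolding zf
    by (simp add: expand h_AB h_Y[of 0, folded c_def] mult_assoc_rule[OF h_Y[of 0, folded c_def]])
  then have 1: "tens h 1 * zmul ?fe - zmul ?fe * tens h 1
      = - (c *\<^sub>C tens (A * Y 1 - Y 1 * A) (B.e 0))"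
    by (metis tens_zmul(1) tens_mult tens_diff(1) mult_1 mult_1_right tens_scale(1) tens_minus(1))
  have "h * zmul (B.e 0) - zmul (B.e 0) * h = c *\<^sub>C (X 1 * B - B * X 1)"
    unfolding ze
    by (simp add: expand h_AB h_X[of 0, folded c_def] mult_assoc_rule[OF h_X[of 0, folded c_def]])
  then have 2: "tens 1 h * zmul ?fe - zmul ?fe * tens 1 h
      = c *\<^sub>C tens (A.f 0) (X 1 * B - B * X 1)"
    by (metis tens_zmul(2) tens_mult tens_diff(2) mult_1 mult_1_right tens_scale(2))
  \<comment> \<open>f commutes with \<open>Y 1\<close> and e with \<open>X 1\<close>, so the
    correction term of H interacts only with A \<otimes> B.\<close>
  have 3: "tens (Y 1) (X 1) * zmul ?fe = zmul ?fe * tens (Y 1) (X 1)"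
    by (simp add: tens_linear zmul_linear A.f_Y(2)[OF A.Y_Y, of 0, simplified]
        B.X_e(2)[OF B.X_X, of 0, simplified])
  have 4: "(tens h 1 + tens 1 h) * tens A B = tens A B * (tens h 1 + tens 1 h)"
    by (simp add: tens_linear h_A expand)
  have "H * R - R * H = q *\<^sub>C (tens h 1 * zmul ?fe - zmul ?fe * tens h 1)
      + q *\<^sub>C (tens 1 h * zmul ?fe - zmul ?fe * tens 1 h)
      - s *\<^sub>C (tens (Y 1) (X 1) * tens A B - tens A B * tens (Y 1) (X 1))
      + ((tens h 1 + tens 1 h) * tens A B - tens A B * (tens h 1 + tens 1 h))
      - s *\<^sub>C q *\<^sub>C
          (tens (Y 1) (X 1) * zmul ?fe - zmul ?fe * tens (Y 1) (X 1))"
    unfolding H[folded c_def, folded s_def] R_def by (simp add: expand scaleC_scaleC mult.commute)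
  also have "\<dots> = c *\<^sub>C (q *\<^sub>C tens (A.f 0) (X 1 * B - B * X 1)
      - q *\<^sub>C tens (A * Y 1 - Y 1 * A) (B.e 0)
      - (q - inverse q) *\<^sub>C (tens (Y 1) (X 1) * tens A B - tens A B * tens (Y 1) (X 1)))"
    unfolding 1 2 3 4 by (simp add: s_def scaleC_linear scaleC_scaleC mult.commute)
  also have "\<dots> = 0"
    by (simp add: A.f_def B.e_def qbracket_def expand tens_linear A.scalars
        cvec.scale_left_diff_distrib)
  finally show ?thesis by simp
qed

text \<open>H commutes with R, so taking the commutator of H with the relation at n raises every
  mode by one, up to the nonzero scalar q^2 - q^-2.\<close>

lemma XV_R: "XV n * R = R * XV n + zmul (qbracket q (XV (Suc n)) R)"
proof (induction n)
  case 0
  then show ?case using XV_0_R e_R by simp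
next
  case (Suc n)
  define c where "c = q * q - inverse q * inverse q"
  note H_X = H_XV[folded c_def]
  have move: "c *\<^sub>C inverse q *\<^sub>C v = inverse q *\<^sub>C c *\<^sub>C v" for v :: "'b fps"
    by (simp add: scaleC_scaleC mult.commute)
  note IH = Suc[unfolded qbracket_def]
  have "H * (XV n * R) - (XV n * R) * H
      = H * (R * XV n + zmul (XV (Suc n) * R - inverse q *\<^sub>C inverse q *\<^sub>C (R * XV (Suc n))))
      - (R * XV n + zmul (XV (Suc n) * R - inverse q *\<^sub>C inverse q *\<^sub>C (R * XV (Suc n)))) * H"
    by (simp add: IH)
  then have "c *\<^sub>C (XV (Suc n) * R) = c *\<^sub>C (R * XV (Suc n) +
      zmul (qbracket q (XV (Suc (Suc n))) R))"
    by (simp add: qbracket_def expand H_X[of n] H_X[of "Suc n"] mult_assoc_rule[OF H_X[of n]]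
        mult_assoc_rule[OF H_X[of "Suc n"]] H_R mult_assoc_rule[OF H_R] move)
  then show ?case
    using q_fourth by (simp add: c_def)
qed

lemma R_YV: "R * YV n = YV n * R + zmul (qbracket q R (YV (Suc n)))"
proof (induction n)
  case 0
  then show ?case using R_YV_0 f_R by simp
next
  case (Suc n)
  define c where "c = q * q - inverse q * inverse q"
  note H_Y = H_YV[folded c_def]
  have move: "c *\<^sub>C inverse q *\<^sub>C v = inverse q *\<^sub>C c *\<^sub>C v" for v :: "'b fps"
    by (simp add: scaleC_scaleC mult.commute)
  note IH = Suc[unfolded qbracket_def]
  have "(R * YV n) * H - H * (R * YV n)
      = (YV n * R + zmul (R * YV (Suc n) - inverse q *\<^sub>C inverse q *\<^sub>C (YV (Suc n) * R))) * H
      - H * (YV n * R + zmul (R * YV (Suc n) - inverse q *\<^sub>C inverse q *\<^sub>C (YV (Suc n) * R)))"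
    by (simp add: IH)
  then have "c *\<^sub>C (R * YV (Suc n)) = c *\<^sub>C (YV (Suc n) * R +
      zmul (qbracket q R (YV (Suc (Suc n)))))"
    by (simp add: qbracket_def expand H_Y[of n] H_Y[of "Suc n"] mult_assoc_rule[OF H_Y[of n]]
        mult_assoc_rule[OF H_Y[of "Suc n"]] H_R mult_assoc_rule[OF H_R] move)
  then show ?case
    using q_fourth by (simp add: c_def)
qed

sublocale RV: current_pair q XV YV R
  by unfold_locales (fact A.q_nonzero XV_R R_YV)+

text \<open>The left-hand side is the entry d of R as it occurs in
  \<open>quantum_determinant\<close>; the right-hand side is the lower right entry of the matrix
  product.\<close>

lemma d_R:
  "RV.e 0 * YV 0 - YV 0 * RV.e 0 + inverse q *\<^sub>C (R * tens k' k') =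
    zmul (tens (A.e 0) (B.f 0)) + q *\<^sub>C tens A.d B.d"
proof -
  have e: "RV.e 0 = tens (A.e 0) B + q *\<^sub>C tens A.d (B.e 0)"
    using e_R by (simp add: RV.e_def)
  have e_k': "B.e 0 * k' = q *\<^sub>C q *\<^sub>C (k' * B.e 0)"
    by (simp add: B.e_def qbracket_def expand B.move_k B.scalars)
  have f_k': "A.f 0 * k' = inverse q *\<^sub>C inverse q *\<^sub>C (k' * A.f 0)"
    by (simp add: A.f_def qbracket_def expand A.move_k A.scalars)
  have B_Y: "B * Y 0 = Y 0 * B + zmul (B.f 0)"
    by (simp add: B.A_Y[of 0] B.f_def)
  have e_Y: "B.e 0 * Y 0 = Y 0 * B.e 0 + B.d - inverse q *\<^sub>C (k' * B)"
    using B.e_Y_commutator by (simp add: algebra_simps)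
  have e_Y': "A.e 0 * Y 0 = Y 0 * A.e 0 + A.d - inverse q *\<^sub>C (k' * A)"
    using A.e_Y_commutator by (simp add: algebra_simps)
  have d_Y: "A.d * Y 0 = inverse q *\<^sub>C inverse q *\<^sub>C (Y 0 * A.d)
      - zmul (inverse q *\<^sub>C (A.f 0 * k'))"
    using A.d_Y by (simp add: algebra_simps)
  show ?thesis
    unfolding e unfolding R_def YV
    by (simp add: expand tens_linear B_Y e_Y e_Y' d_Y e_k' f_k' A.A_k B.A_k A.scalars)
qed

text \<open>Group the expansion by the products A'' e, A'' d, f'' e and f'' d in the first factor.
  The cofactors of A'' e and f'' d vanish; those of A'' d and f'' e are the determinant of B in its
  two forms, up to sign and powers of q and z.\<close>

lemma determinant_R:
  assumes QA: "qdilate q A * A.d - zmul (qdilate q (A.f 0) * A.e 0) = inverse q *\<^sub>C (k * NA)"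
    and QB: "qdilate q B * B.d - zmul (qdilate q (B.f 0) * B.e 0) = inverse q *\<^sub>C (k * NB)"
    and NB: "\<And>w. NB * w = w * NB"
  shows "qdilate q R * (RV.e 0 * YV 0 - YV 0 * RV.e 0 + inverse q *\<^sub>C (R * tens k' k'))
    - zmul (qdilate q (RV.f 0) * RV.e 0) = inverse q *\<^sub>C tens (k * NA) (k * NB)"
proof -
  have e: "RV.e 0 = tens (A.e 0) B + q *\<^sub>C tens A.d (B.e 0)"
    using e_R by (simp add: RV.e_def)
  have f: "qdilate q (RV.f 0) = tens (qdilate q A) (qdilate q (B.f 0))
      + q *\<^sub>C tens (qdilate q (A.f 0)) (qdilate q B.d)"
    using f_R by (simp add: RV.f_def fps_dilate_linear tens_dilate)
  have R: "qdilate q R = tens (qdilate q A) (qdilate q B)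
      + zmul (q *\<^sub>C q *\<^sub>C q *\<^sub>C tens (qdilate q (A.f 0)) (qdilate q (B.e 0)))"
    by (simp add: R_def fps_dilate_linear tens_dilate scaleC_scaleC mult.assoc)
  have dual: "qdilate q B.d * B = qdilate q B * B.d - zmul (qdilate q (B.f 0) * B.e 0)
      + zmul (q *\<^sub>C q *\<^sub>C (qdilate q (B.e 0) * B.f 0))"
    using B.dual_determinant by (simp add: algebra_simps)
  have "NB' * w = w * NB'" if "NB' = inverse q *\<^sub>C NB" for w NB'
    using NB that by (simp add: expand)
  \<comment> \<open>This removes the cofactor of f'' d; it is where \<open>NB\<close> has to be
    central.\<close>
  then have ed: "qdilate q B.d * B.e 0 = q *\<^sub>C q *\<^sub>C (qdilate q (B.e 0) * B.d)"
    using B.dilate_e_d[of "inverse q *\<^sub>C NB"] QB by (simp add: expand)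
  have "qdilate q R * (RV.e 0 * YV 0 - YV 0 * RV.e 0 + inverse q *\<^sub>C (R * tens k' k'))
      - zmul (qdilate q (RV.f 0) * RV.e 0) =
    q *\<^sub>C tens (qdilate q A * A.d - zmul (qdilate q (A.f 0) * A.e 0))
      (qdilate q B * B.d - zmul (qdilate q (B.f 0) * B.e 0))"
    unfolding d_R unfolding e f unfolding R
    by (simp add: expand tens_linear dual ed B.dilate_A_f[OF B.dilate_Y] A.scalars)
  also have "\<dots> = inverse q *\<^sub>C tens (k * NA) (k * NB)"
    unfolding QA QB by (simp add: tens_linear A.q_cancel)
  finally show ?thesis .
qed

end

section \<open>The quantum affine algebra\<close>

fun opp :: "sign \<Rightarrow> sign" where
  "opp Pos = Neg"
| "opp Neg = Pos"

section \<open>Commutation and cancellation in series and subalgebras\<close>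

lemma fps_mult_commute_coeffs:
  fixes F G :: "'a::semiring_0 fps"
  assumes "\<And>i j. F $ i * G $ j = G $ j * F $ i"
  shows "F * G = G * F"
proof (rule fps_ext)
  fix n
  show "(F * G) $ n = (G * F) $ n"
    unfolding fps_mult_nth
    by (rule sum.reindex_bij_witness[of _ "\<lambda>i. n - i" "\<lambda>i. n - i"]) (auto simp: assms)
qed

text \<open>N is cancelled without forming its inverse: the lowest nonzero coefficient of W would
  survive in W N.\<close>

lemma mult_eq_zero_lowest:
  fixes W N :: "'a::complex_algebra_1 fps"
  assumes "W * N = 0" "N $ 0 = 1"
  shows "W = 0"
proof -
  have "W $ n = 0" for n
  proof (induction n rule: less_induct)
    case (less n)
    then have "(W * N) $ n = W $ n"
      using assms(2) by (simp add: mult_nth_lowest)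
    then show ?case using assms(1) by simp
  qed
  then show ?thesis by (simp add: fps_eq_iff)
qed

lemma generated_subalgebra_commute:
  assumes "u \<in> generated_subalgebra S" "\<And>v. v \<in> S \<Longrightarrow> w * v = v * w"
  shows "w * u = u * w"
  using assms(1)
proof induction
  case (mult u v)
  then show ?case by (metis mult.assoc)
qed (use assms(2) in \<open>auto simp: distrib_left distrib_right scaleC_linear\<close>)

lemma generated_subalgebra_zero: "0 \<in> generated_subalgebra S"
  using generated_subalgebra.scale[OF generated_subalgebra.one, of 0 S] by simp

lemma generated_subalgebra_diff:
  "u \<in> generated_subalgebra S \<Longrightarrow> v \<in> generated_subalgebra S \<Longrightarrow> u - v \<in> generated_subalgebra S"
  using generated_subalgebra.add[of u S "(-1) *\<^sub>C v"] generated_subalgebra.scale[of v S "-1"]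
  by simp

lemma generated_subalgebra_mult_nth:
  assumes "\<And>i. F $ i \<in> generated_subalgebra S" "\<And>i. G $ i \<in> generated_subalgebra S"
  shows "(F * G) $ n \<in> generated_subalgebra S"
proof -
  have "(\<Sum>i\<in>I. h i) \<in> generated_subalgebra S" if "finite I" "\<And>i. h i \<in> generated_subalgebra S"
    for I :: "nat set" and h
    using that by (induction I) (auto intro: generated_subalgebra_zero generated_subalgebra.add)
  then show ?thesis
    using assms by (simp add: fps_mult_nth generated_subalgebra.mult)
qed

lemma double_eq_zero:
  fixes u v :: "'a::complex_vector"
  assumes "u - v = v - u"
  shows "u = v"
proof -
  have "(1 + 1) *\<^sub>C (u - v) = 0"
    unfolding scaleC_add_left scaleC_one using assms by (simp add: algebra_simps)
  then show ?thesis by simp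
qed

text \<open>Scaling by the inverse of c' gives a relation of the same shape with the products
  rearranged. This is what reversing the modes does to the quadratic relations.\<close>

lemma rescale_relation:
  fixes u v w y :: "'a::complex_vector"
  assumes "u - c' *\<^sub>C v = c' *\<^sub>C w - y" "\<And>z :: 'a. c *\<^sub>C c' *\<^sub>C z = z"
  shows "v - c *\<^sub>C u = c *\<^sub>C y - w"
proof -
  have "u + y = c' *\<^sub>C (v + w)"
    using assms(1) by (simp add: scaleC_add_right algebra_simps)
  then have "c *\<^sub>C (u + y) = v + w"
    using assms(2) by simp
  then show ?thesis by (simp add: scaleC_add_right algebra_simps)
qed

definition fps_scalars :: "complex fps \<Rightarrow> 'a::complex_algebra_1 fps" where
  "fps_scalars = fps_map (\<lambda>c. c *\<^sub>C 1)"

lemma fps_scalars_nth: "fps_scalars F $ n = (F $ n) *\<^sub>C 1"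
  by (simp add: fps_scalars_def fps_map_def)

lemma fps_scalars_commute: "fps_scalars F * W = W * fps_scalars F"
  by (rule fps_mult_commute_coeffs) (simp add: fps_scalars_nth scaleC_linear)

text \<open>Only the relations are assumed, not the presentation, so that the reversed family of
  generators is easily seen to be an instance again.\<close>

locale drinfeld =
  fixes q :: complex and x \<phi> :: "sign \<Rightarrow> int \<Rightarrow> 'u::complex_algebra_1"
  assumes q_nonzero: "q \<noteq> 0"
    and not_root_of_unity: "n > 0 \<Longrightarrow> q ^ n \<noteq> 1"
    and relators: "u \<in> uq_relators q x \<phi> \<Longrightarrow> u = 0"
begin

lemma q_powi: "q powi 2 = q * q" "q powi (- 2) = inverse q * inverse q"
  by (simp_all add: power_int_def power2_eq_square)

text \<open>q^(2n) = -1 would force n > 0 and q^(4n) = 1. These are the factors 1 + c^n of the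
  degreewise equations.\<close>

lemma one_plus_power: "1 + (q * q) ^ n \<noteq> 0" "1 + (inverse q * inverse q) ^ n \<noteq> 0"
proof -
  have "(u * u) ^ n = u ^ (2 * n)" for u :: complex
    by (simp add: power_mult power2_eq_square)
  moreover have *: "q ^ (2 * n) \<noteq> - 1"
  proof
    assume "q ^ (2 * n) = - 1"
    then have "n > 0" by (cases n) auto
    moreover have "q ^ (4 * n) = q ^ (2 * n) * q ^ (2 * n)"
      by (simp flip: power_add)
    moreover note \<open>q ^ (2 * n) = - 1\<close>
    ultimately show False using not_root_of_unity[of "4 * n"] by simp
  qed
  moreover have "inverse (q ^ (2 * n)) \<noteq> - 1"
    using * by (metis inverse_inverse_eq inverse_minus_eq inverse_1)
  ultimately show "1 + (q * q) ^ n \<noteq> 0" "1 + (inverse q * inverse q) ^ n \<noteq> 0"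
    by (simp_all add: power_inverse add_eq_0_iff add.commute)
qed

lemma q_square: "q - inverse q \<noteq> 0" "q * q - inverse q * inverse q \<noteq> 0"
proof -
  show "q - inverse q \<noteq> 0"
    using not_root_of_unity[of 2] q_nonzero by (auto simp: field_simps power2_eq_square)
  show "q * q - inverse q * inverse q \<noteq> 0"
    using not_root_of_unity[of 4] q_nonzero by (auto simp: field_simps power4_eq_xxxx)
qed

definition r :: complex where "r = 1 / (q - inverse q)"

lemma \<phi>_zero: "m < 0 \<Longrightarrow> \<phi> Pos m = 0" "m > 0 \<Longrightarrow> \<phi> Neg m = 0"
  by (rule relators; unfold uq_relators_def; blast)+

lemma \<phi>_commute: "\<phi> s m * \<phi> e n = \<phi> e n * \<phi> s m"
proof -
  have "commutator (\<phi> s m) (\<phi> e n) = 0"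
    by (rule relators) (unfold uq_relators_def; blast)
  then show ?thesis by (simp add: commutator_def)
qed

lemma \<phi>_inverse: "\<phi> Pos 0 * \<phi> Neg 0 = 1" "\<phi> Neg 0 * \<phi> Pos 0 = 1"
proof -
  have "\<phi> Pos 0 * \<phi> Neg 0 - 1 = 0"
    by (rule relators) (unfold uq_relators_def; blast)
  then show "\<phi> Pos 0 * \<phi> Neg 0 = 1" "\<phi> Neg 0 * \<phi> Pos 0 = 1"
    by (simp_all add: \<phi>_commute[of Neg])
qed

lemma xx_commutator: "x Pos m * x Neg n - x Neg n * x Pos m = r *\<^sub>C (\<phi> Pos (m + n) - \<phi> Neg (m + n))"
proof -
  have "commutator (x Pos m) (x Neg n) - (1 / (q - inverse q)) *\<^sub>C (\<phi> Pos (m + n) - \<phi> Neg (m +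
      n)) = 0"
    by (rule relators) (unfold uq_relators_def; blast)
  then show ?thesis by (simp add: commutator_def r_def)
qed

lemma \<phi>_x:
  "\<phi> e (m + 1) * x s n - q powi (2 * sign_int s) *\<^sub>C (\<phi> e m * x s (n + 1)) =
   q powi (2 * sign_int s) *\<^sub>C (x s n * \<phi> e (m + 1)) - x s (n + 1) * \<phi> e m"
proof -
  have "(\<phi> e (m + 1) * x s n - q powi (2 * sign_int s) *\<^sub>C (\<phi> e m * x s (n + 1)))
    - (q powi (2 * sign_int s) *\<^sub>C (x s n * \<phi> e (m + 1)) - x s (n + 1) * \<phi> e m) = 0"
    by (rule relators) (unfold uq_relators_def; blast)
  then show ?thesis by simp
qed

lemma x_x: "x s (m + 1) * x s m = q powi (2 * sign_int s) *\<^sub>C (x s m * x s (m + 1))"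
proof -
  have "(x s (m + 1) * x s m - q powi (2 * sign_int s) *\<^sub>C (x s m * x s (m + 1)))
        - (q powi (2 * sign_int s) *\<^sub>C (x s m * x s (m + 1)) - x s (m + 1) * x s m) = 0"
    by (rule relators) (unfold uq_relators_def; blast)
  then show ?thesis unfolding right_minus_eq by (rule double_eq_zero)
qed

lemma k_x: "\<phi> Pos 0 * x s n = q powi (2 * sign_int s) *\<^sub>C (x s n * \<phi> Pos 0)"
  \<comment> \<open>At m = -1 the terms with \<phi>^+_{-1} vanish.\<close>
  using \<phi>_x[of Pos "-1" s n] by (simp add: \<phi>_zero)

lemma powi_opp:
  "q powi (2 * sign_int s) *\<^sub>C q powi (2 * sign_int (opp s)) *\<^sub>C (w :: 'w::complex_vector) = w"
proof -
  have "q powi (2 * sign_int s) * q powi (2 * sign_int (opp s)) = 1"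
    using q_nonzero by (cases s) (simp_all add: power_int_minus)
  then show ?thesis by (simp add: scaleC_scaleC scaleC_one)
qed

text \<open>The automorphism \<open>x\<^sup>\<plusminus>\<^sub>m \<mapsto> x\<^sup>\<mp>\<^sub>-\<^sub>m\<close>, \<open>\<phi>\<^sup>\<plusminus>\<^sub>m \<mapsto> \<phi>\<^sup>\<mp>\<^sub>-\<^sub>m\<close> exchanges series in \<open>z\<close> and in \<open>z\<inverse>\<close>.\<close>

lemma drinfeld_opp: "drinfeld q (\<lambda>s m. x (opp s) (- m)) (\<lambda>e m. \<phi> (opp e) (- m))"
proof unfold_locales
  fix u
  assume "u \<in> uq_relators q (\<lambda>s m. x (opp s) (- m)) (\<lambda>e m. \<phi> (opp e) (- m))"
  then consider (1) m where "u = \<phi> Neg (- m)" "m < 0" | (2) m where "u = \<phi> Pos (- m)" "m > 0"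
    | (3) "u = \<phi> Neg 0 * \<phi> Pos 0 - 1" | (4) s e m n where "u =
        commutator (\<phi> (opp s) (- m)) (\<phi> (opp e) (- n))"
    | (5) m n where "u = commutator (x Neg (- m)) (x Pos (- n))
        - (1 / (q - inverse q)) *\<^sub>C (\<phi> Neg (- (m + n)) - \<phi> Pos (- (m + n)))"
    | (6) e s m n where "u = (\<phi> (opp e) (- (m + 1)) * x (opp s) (- n)
        - q powi (2 * sign_int s) *\<^sub>C (\<phi> (opp e) (- m) * x (opp s) (- (n + 1))))
        - (q powi (2 * sign_int s) *\<^sub>C (x (opp s) (- n) * \<phi> (opp e) (- (m + 1)))
            - x (opp s) (- (n + 1)) * \<phi> (opp e) (- m))"
    | (7) s m n where "u = (x (opp s) (- (m + 1)) * x (opp s) (- n)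
        - q powi (2 * sign_int s) *\<^sub>C (x (opp s) (- m) * x (opp s) (- (n + 1))))
        - (q powi (2 * sign_int s) *\<^sub>C (x (opp s) (- n) * x (opp s) (- (m + 1)))
            - x (opp s) (- (n + 1)) * x (opp s) (- m))"
    unfolding uq_relators_def by auto
  then show "u = 0"
  proof cases
    case 5
    then show ?thesis
      using xx_commutator[of "- n" "- m"]
      by (simp add: commutator_def r_def cvec.scale_right_diff_distrib algebra_simps)
  next
    case (6 e s m n)
    have "\<phi> (opp e) (- m) * x (opp s) (- n - 1)
        - q powi (2 * sign_int (opp s)) *\<^sub>C (\<phi> (opp e) (- m - 1) * x (opp s) (- n)) =
      q powi (2 * sign_int (opp s)) *\<^sub>C (x (opp s) (- n - 1) * \<phi> (opp e) (- m))
          - x (opp s) (- n) * \<phi> (opp e) (- m - 1)"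
      using \<phi>_x[of "opp e" "- m - 1" "opp s" "- n - 1"] by simp
    from rescale_relation[OF this powi_opp] show ?thesis
      by (simp add: 6)
  next
    case (7 s m n)
    have "(x (opp s) ((- m - 1) + 1) * x (opp s) (- n - 1)
        - q powi (2 * sign_int (opp s)) *\<^sub>C (x (opp s) (- m - 1) * x (opp s) ((- n - 1) + 1)))
        - (q powi (2 * sign_int (opp s)) *\<^sub>C (x (opp s) (- n - 1) * x (opp s) ((- m - 1) + 1))
            - x (opp s) ((- n - 1) + 1) * x (opp s) (- m - 1)) = 0"
      by (rule relators) (unfold uq_relators_def; blast)
    then have "x (opp s) (- m) * x (opp s) (- n - 1)
        - q powi (2 * sign_int (opp s)) *\<^sub>C (x (opp s) (- m - 1) * x (opp s) (- n)) =
        q powi (2 * sign_int (opp s)) *\<^sub>C (x (opp s) (- n - 1) * x (opp s) (- m))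
            - x (opp s) (- n) * x (opp s) (- m - 1)"
      by simp
    from rescale_relation[OF this powi_opp] show ?thesis
      by (simp add: 7)
  qed (auto simp: \<phi>_zero \<phi>_inverse commutator_def \<phi>_commute)
qed (use q_nonzero not_root_of_unity in auto)

end

section \<open>Solutions of the defining equation at positive sign\<close>

context drinfeld
begin

abbreviation k :: "'u fps" where "k \<equiv> fps_const (\<phi> Pos 0)"
abbreviation k' :: "'u fps" where "k' \<equiv> fps_const (\<phi> Neg 0)"
abbreviation P :: "'u fps" where "P \<equiv> phi_series \<phi> Pos"
abbreviation cx :: "sign \<Rightarrow> int \<Rightarrow> 'u fps" where "cx s n \<equiv> fps_const (x s n)"

definition A_solution :: "'u fps \<Rightarrow> 'u fps \<Rightarrow> bool" where
  "A_solution N A \<longleftrightarrow> A $ 0 = 1 \<and> (\<forall>n. A $ n \<in> generated_subalgebra {\<phi> s m | s m. True}) \<and>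
     P * (A * qdilate q A) = k * N"

lemma subalgebra_commute:
  assumes "u \<in> generated_subalgebra {\<phi> s m | s m. True}"
    "w \<in> generated_subalgebra {\<phi> s m | s m. True}"
  shows "w * u = u * w"
  using assms(1)
proof (rule generated_subalgebra_commute)
  fix v assume "v \<in> {\<phi> s m | s m. True}"
  then obtain s m where v: "v = \<phi> s m" by auto
  have "v * w = w * v"
    using assms(2) by (rule generated_subalgebra_commute) (auto simp: v \<phi>_commute)
  then show "w * v = v * w" by simp
qed

lemma phi_in_subalgebra: "\<phi> s m \<in> generated_subalgebra {\<phi> s m | s m. True}"
  by (rule generated_subalgebra.gen) blast

lemma subalgebra_series_commute:
  assumes "\<And>n. F $ n \<in> generated_subalgebra {\<phi> s m | s m. True}"
    "\<And>n. G $ n \<in> generated_subalgebra {\<phi> s m | s m. True}"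
  shows "F * G = G * F"
  using assms by (intro fps_mult_commute_coeffs subalgebra_commute)

lemma fps_const_in_subalgebra:
  assumes "u \<in> generated_subalgebra S"
  shows "fps_const u $ n \<in> generated_subalgebra S"
  using assms by (simp add: generated_subalgebra_zero)

lemma k_inverse: "k * k' = 1" "k' * k = 1"
  by (simp_all add: \<phi>_inverse)

lemma P_x:
  "P * cx s n - c *\<^sub>C zmul (P * cx s (n + 1)) = c *\<^sub>C (cx s n * P) - zmul (cx s (n + 1) * P)"
  if "c = q powi (2 * sign_int s)"
proof (rule fps_ext)
  fix j
  show "(P * cx s n - c *\<^sub>C zmul (P * cx s (n + 1))) $ j =
    (c *\<^sub>C (cx s n * P) - zmul (cx s (n + 1) * P)) $ j"
    using \<phi>_x[of Pos "int j - 1" s n]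
    by (cases j) (simp_all add: that phi_series_def \<phi>_zero add.commute)
qed

lemma k_cx: "k * cx s n = q powi (2 * sign_int s) *\<^sub>C (cx s n * k)"
  by (simp add: k_x flip: fps_const_scaleC)

text \<open>G will be A A'', which inverts P up to k and the central N. Multiplying P X = X' P by G
  on both sides turns the exchange relation of P into one for G; moving k past X costs the factor
  c.\<close>

lemma inverse_P_x:
  fixes G N :: "'u fps"
  assumes c: "c = q powi (2 * sign_int s)" and PG: "P * G = k * N" "G * P = k * N" "G * k = k * G"
    and N: "\<And>W. N * W = W * N" "N $ 0 = 1"
  shows "G * cx s n - inverse c *\<^sub>C zmul (G * cx s (n + 1)) = cx s n * G - c *\<^sub>C zmul (cx s (n +
      1) * G)"
proof -
  define X where "X = cx s n - c *\<^sub>C zmul (cx s (n + 1))"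
  define X' where "X' = c *\<^sub>C cx s n - zmul (cx s (n + 1))"
  have kX: "k * X = c *\<^sub>C (X * k)"
    unfolding X_def by (simp add: expand k_cx c del: fps_const_mult)
  have PX: "P * X = X' * P"
    using P_x[OF c, of n] by (simp add: X_def X'_def expand)
  have "k * (N * (X * G)) = G * (P * (X * G))"
    by (simp add: PG flip: mult.assoc)
  also have "\<dots> = G * (X' * (P * G))"
    by (simp add: mult_assoc_rule[OF PX] mult.assoc)
  also have "\<dots> = G * X' * k * N"
    by (simp add: PG mult.assoc)
  also have "k * (N * (X * G)) = c *\<^sub>C (X * G * k * N)"
    by (simp add: N(1) mult.assoc mult_assoc_rule[OF kX] mult_assoc_rule[OF PG(3)] expand del: fps_const_mult)
  finally have "((c *\<^sub>C (X * G) - G * X') * k) * N = 0"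
    by (simp add: expand del: fps_const_mult)
  then have "(c *\<^sub>C (X * G) - G * X') * k = 0"
    using N(2) by (rule mult_eq_zero_lowest)
  then have "(c *\<^sub>C (X * G) - G * X') * (k * k') = 0"
    by (simp only: flip: mult.assoc) simp
  then have "c *\<^sub>C (X * G) = G * X'"
    by (simp add: \<phi>_inverse)
  from arg_cong[OF this, of "scaleC (inverse c)"] have "X * G = inverse c *\<^sub>C (G * X')"
    using q_nonzero by (simp add: c scaleC_inverse_cancel)
  then show ?thesis
    using q_nonzero by (simp add: X_def X'_def expand c scaleC_inverse_cancel)
qed

lemma q_powi_scaleC:
  "q powi (2 * sign_int Pos) *\<^sub>C (w :: 'w::complex_vector) = q *\<^sub>C q *\<^sub>C w"
  "q powi (2 * sign_int Neg) *\<^sub>C w = inverse q *\<^sub>C inverse q *\<^sub>C w"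
  by (simp_all add: scaleC_scaleC power2_eq_square power_int_minus)

lemmas x_x' = x_x[of Pos, unfolded q_powi_scaleC] x_x[of Neg, unfolded q_powi_scaleC]
lemmas k_x' = k_x[of Pos, unfolded q_powi_scaleC] k_x[of Neg, unfolded q_powi_scaleC]
lemmas \<phi>_x' = \<phi>_x[of _ _ Pos, unfolded q_powi_scaleC] \<phi>_x[of _ _ Neg, unfolded q_powi_scaleC]

lemma k'_x: "x s n * \<phi> Neg 0 = q powi (2 * sign_int s) *\<^sub>C (\<phi> Neg 0 * x s n)"
proof -
  have "\<phi> Neg 0 * (\<phi> Pos 0 * x s n) * \<phi> Neg 0 =
      q powi (2 * sign_int s) *\<^sub>C (\<phi> Neg 0 * x s n * (\<phi> Pos 0 * \<phi> Neg 0))"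
    unfolding k_x by (simp add: scaleC_linear mult.assoc)
  then show ?thesis
    using \<phi>_inverse by (metis mult.assoc mult_1 mult_1_right)
qed

lemmas k'_x' = k'_x[of Pos, unfolded q_powi_scaleC] k'_x[of Neg, unfolded q_powi_scaleC]

lemmas q_cancel = scaleC_inverse_cancel[OF q_nonzero]

text \<open>The shift by one makes \<open>X 0\<close> and \<open>Y 0\<close> the modes x^+_{-1} and
  x^-_0 of the commutators in the formula at positive sign.\<close>

definition X :: "nat \<Rightarrow> 'u fps" where "X n = cx Pos (int n - 1)"
definition Y :: "nat \<Rightarrow> 'u fps" where "Y n = cx Neg (int n)"

context
  fixes N A :: "'u fps"
  assumes sol: "A_solution N A" and N: "\<And>W. N * W = W * N" "N $ 0 = 1"
begin

private lemma A_subalgebra: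
  "A $ n \<in> generated_subalgebra {\<phi> s m | s m. True}"
  "qdilate q A $ n \<in> generated_subalgebra {\<phi> s m | s m. True}"
  using sol by (auto simp: A_solution_def intro: generated_subalgebra.scale)

lemma A_solution_commute:
  "A * qdilate q A = qdilate q A * A" "A * fps_const (\<phi> s m) = fps_const (\<phi> s m) * A"
  "qdilate q A * fps_const (\<phi> s m) = fps_const (\<phi> s m) * qdilate q A"
  "P * A = A * P" "P * qdilate q A = qdilate q A * P"
proof -
  have "P $ n \<in> generated_subalgebra {\<phi> s m | s m. True}" for n
    unfolding phi_series_def using phi_in_subalgebra by simp
  note mem = A_subalgebra this fps_const_in_subalgebra[OF phi_in_subalgebra]
  show "A * qdilate q A = qdilate q A * A" "A * fps_const (\<phi> s m) = fps_const (\<phi> s m) * A"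
    "qdilate q A * fps_const (\<phi> s m) = fps_const (\<phi> s m) * qdilate q A"
    "P * A = A * P" "P * qdilate q A = qdilate q A * P"
    by (rule subalgebra_series_commute; rule mem)+
qed

lemma A_solution_x:
  assumes c: "c = q powi (2 * sign_int s)"
  shows "A * qdilate q A * cx s n - inverse c *\<^sub>C zmul (A * qdilate q A * cx s (n + 1)) =
    cx s n * (A * qdilate q A) - c *\<^sub>C zmul (cx s (n + 1) * (A * qdilate q A))"
proof (rule inverse_P_x[OF c _ _ _ N])
  show "P * (A * qdilate q A) = k * N"
    using sol by (simp add: A_solution_def)
  then show "A * qdilate q A * P = k * N"
    by (metis A_solution_commute(4,5) mult.assoc)
  show "A * qdilate q A * k = k * (A * qdilate q A)"
    by (metis A_solution_commute(2,3) mult.assoc)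
qed

text \<open>A square root of the exchange relation for A A'': if D is the defect of the claim, that
  relation reads A'' D + D'' A = 0, and the Sylvester argument gives D = 0.\<close>

lemma A_solution_X: "X n * A = A * X n + zmul (qbracket q (X (Suc n)) A)"
proof -
  define x0 where "x0 = X n"
  define x1 where "x1 = X (Suc n)"
  define B where "B = qdilate q A"
  have dil: "qdilate q x0 = x0" "qdilate q x1 = x1"
    by (simp_all add: x0_def x1_def X_def fps_dilate_linear)
  define D where "D = A * x0 - inverse q *\<^sub>C inverse q *\<^sub>C zmul (A * x1) - x0 * A + zmul (x1 * A)"
  have D': "qdilate q D = B * x0 - zmul (B * x1) - x0 * B + q *\<^sub>C q *\<^sub>C zmul (x1 * B)"
    by (simp add: D_def fps_dilate_linear fps_dilate_mult dil B_def q_nonzero expand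
        scaleC_inverse_cancel flip: scaleC_scaleC)
  have "A * B * x0 - inverse q *\<^sub>C inverse q *\<^sub>C zmul (A * B * x1) =
      x0 * (A * B) - q *\<^sub>C q *\<^sub>C zmul (x1 * (A * B))"
    using A_solution_x[of "q powi 2" Pos "int n - 1"]
    by (simp add: x0_def x1_def X_def B_def scaleC_scaleC power2_eq_square)
  then have "A * B * x0 - inverse q *\<^sub>C inverse q *\<^sub>C zmul (A * B * x1) -
      (x0 * (A * B) - q *\<^sub>C q *\<^sub>C zmul (x1 * (A * B))) = 0"
    by simp
  also have "A * B = B * A"
    by (simp add: B_def A_solution_commute)
  finally have "B * D + qdilate q D * A = 0"
    unfolding D' by (simp add: D_def expand)
  moreover have "A $ 0 = 1" "B $ 0 = 1"
    using sol by (simp_all add: A_solution_def B_def scaleC_one)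
  ultimately have "D = 0"
    using one_plus_power(1) by (intro sylvester_zero_left[of B A D "q * q"]) auto
  then show ?thesis
    unfolding D_def x0_def x1_def by (simp add: qbracket_def expand algebra_simps)
qed

lemma A_solution_Y: "A * Y n = Y n * A + zmul (qbracket q A (Y (Suc n)))"
proof -
  define y0 where "y0 = Y n"
  define y1 where "y1 = Y (Suc n)"
  define B where "B = qdilate q A"
  have dil: "qdilate q y0 = y0" "qdilate q y1 = y1"
    by (simp_all add: y0_def y1_def Y_def fps_dilate_linear)
  define D where "D = A * y0 - zmul (A * y1) - y0 * A + inverse q *\<^sub>C inverse q *\<^sub>C zmul (y1 * A)"
  have D': "qdilate q D = B * y0 - q *\<^sub>C q *\<^sub>C zmul (B * y1) - y0 * B + zmul (y1 * B)"
    by (simp add: D_def fps_dilate_linear fps_dilate_mult dil B_def q_nonzero expand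
        scaleC_inverse_cancel flip: scaleC_scaleC)
  have "A * B * y0 - q *\<^sub>C q *\<^sub>C zmul (A * B * y1) =
      y0 * (A * B) - inverse q *\<^sub>C inverse q *\<^sub>C zmul (y1 * (A * B))"
    using A_solution_x[of "q powi (- 2)" Neg "int n"]
    by (simp add: y0_def y1_def Y_def B_def scaleC_scaleC q_powi[unfolded power2_eq_square] add.commute
        power_int_minus power2_eq_square)
  then have "A * B * y0 - q *\<^sub>C q *\<^sub>C zmul (A * B * y1) -
      (y0 * (A * B) - inverse q *\<^sub>C inverse q *\<^sub>C zmul (y1 * (A * B))) = 0"
    by simp
  \<comment> \<open>The dilation now falls on the term with D on the right, so the other Sylvester
    lemma applies.\<close>
  then have "A * qdilate q D + D * B = 0"
    unfolding D' by (simp add: D_def expand)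
  moreover have "A $ 0 = 1" "B $ 0 = 1"
    using sol by (simp_all add: A_solution_def B_def scaleC_one)
  ultimately have "D = 0"
    using one_plus_power(1) by (intro sylvester_zero_right[of A B "q * q" D]) auto
  then show ?thesis
    unfolding D_def y0_def y1_def by (simp add: qbracket_def expand algebra_simps)
qed

lemma A_solution_lax:
  "lax q X Y A k k' (fps_const (\<phi> Neg (- 1))) (fps_const (r *\<^sub>C \<phi> Pos 1)) r"
proof
  show "q \<noteq> 0" by (fact q_nonzero)
  show "q * r - inverse q * r = 1"
    using q_square(1) by (simp add: r_def flip: diff_divide_distrib)
  show "X n * A = A * X n + zmul (qbracket q (X (Suc n)) A)"
    "A * Y n = Y n * A + zmul (qbracket q A (Y (Suc n)))" for n
    by (fact A_solution_X A_solution_Y)+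
  show "A * k = k * A" "A * k' = k' * A" "A * fps_const (\<phi> Neg (- 1)) = fps_const (\<phi> Neg (- 1)) * A"
    by (fact A_solution_commute)+
  show "A * fps_const (r *\<^sub>C \<phi> Pos 1) = fps_const (r *\<^sub>C \<phi> Pos 1) * A"
    by (simp add: fps_const_scaleC scaleC_linear A_solution_commute)
  show "k * k' = 1" "k' * k = 1" by (fact k_inverse)+
  have xy: "x Pos m * x Neg n = x Neg n * x Pos m + r *\<^sub>C \<phi> Pos (m + n) - r *\<^sub>C \<phi> Neg (m + n)"
      for m n
    using xx_commutator[of m n] by (simp add: scaleC_linear algebra_simps)
  show "X 0 * Y 0 = Y 0 * X 0 - r *\<^sub>C fps_const (\<phi> Neg (- 1))"
    "X 1 * Y 0 = Y 0 * X 1 + r *\<^sub>C k - r *\<^sub>C k'"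
    "X 0 * Y 1 = Y 1 * X 0 + r *\<^sub>C k - r *\<^sub>C k'"
    "X 1 * Y 1 = Y 1 * X 1 + fps_const (r *\<^sub>C \<phi> Pos 1)"
    by (simp_all add: X_def Y_def xy \<phi>_zero flip: fps_const_scaleC)
  show "X n * X (Suc n) = inverse q *\<^sub>C inverse q *\<^sub>C (X (Suc n) * X n)" for n
    using x_x'(1)[of "int n - 1"] by (simp add: X_def q_cancel flip: fps_const_scaleC)
  show "Y (Suc n) * Y n = inverse q *\<^sub>C inverse q *\<^sub>C (Y n * Y (Suc n))" for n
    using x_x'(2)[of "int n"] by (simp add: Y_def add.commute flip: fps_const_scaleC)
  show "X n * k = inverse q *\<^sub>C inverse q *\<^sub>C (k * X n)" for n
    by (simp add: X_def k_x' q_cancel flip: fps_const_scaleC)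
  show "Y n * k = q *\<^sub>C q *\<^sub>C (k * Y n)" for n
    by (simp add: Y_def k_x' q_cancel flip: fps_const_scaleC)
  have "x Neg 1 * \<phi> Neg (- 1) = inverse q *\<^sub>C inverse q *\<^sub>C (\<phi> Neg (- 1) * x Neg 1)
      - \<phi> Neg 0 * x Neg 0 + inverse q *\<^sub>C inverse q *\<^sub>C (x Neg 0 * \<phi> Neg 0)"
    using \<phi>_x'(2)[of Neg "- 1" 0] by (simp add: algebra_simps)
  then show "Y 1 * fps_const (\<phi> Neg (- 1)) =
      inverse q *\<^sub>C inverse q *\<^sub>C (fps_const (\<phi> Neg (- 1)) * Y 1)
      - k' * Y 0 + inverse q *\<^sub>C inverse q *\<^sub>C inverse q *\<^sub>C inverse q *\<^sub>C (k' * Y 0)"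
    by (simp add: Y_def k'_x' flip: fps_const_scaleC)
  have "x Pos 0 * \<phi> Neg (- 1) = q *\<^sub>C q *\<^sub>C (\<phi> Neg (- 1) * x Pos 0)
      + q *\<^sub>C q *\<^sub>C (x Pos (- 1) * \<phi> Neg 0) - \<phi> Neg 0 * x Pos (- 1)"
    using \<phi>_x'(1)[of Neg "- 1" "- 1"] by (simp add: algebra_simps)
  then show "X 1 * fps_const (\<phi> Neg (- 1)) = q *\<^sub>C q *\<^sub>C (fps_const (\<phi> Neg (- 1)) * X 1)
      + q *\<^sub>C q *\<^sub>C q *\<^sub>C q *\<^sub>C (k' * X 0) - k' * X 0"
    by (simp add: X_def k'_x' flip: fps_const_scaleC)
  show "qdilate q (X n) = X n" "qdilate q (Y n) = Y n" "qdilate q k = k" "qdilate q k' = k'" for n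
    by (simp_all add: X_def Y_def fps_dilate_linear)
qed

text \<open>The half current of the x^+_n with n >= 0 has commutator r (\<phi>^+(z) - \<phi>^-_0)
  with x^-_0. So the determinant is q^-1 A'' A \<phi>^+(z), which the defining equation of A
  evaluates.\<close>

lemma A_solution_determinant:
  "qdilate q A * lax.d q X Y A k
      - zmul (qdilate q (current_pair.f q Y A 0) * current_pair.e q X A 0)
    = inverse q *\<^sub>C (k * N)"
proof -
  interpret lax q X Y A k k' "fps_const (\<phi> Neg (- 1))" "fps_const (r *\<^sub>C \<phi> Pos 1)" r
    by (rule A_solution_lax)
  define S where "S n = Abs_fps (\<lambda>i. x Pos (int n + int i))" for n
  have S: "S n = X (Suc n) + zmul (S (Suc n))" for n
  proof (rule fps_ext)
    fix j
    show "S n $ j = (X (Suc n) + zmul (S (Suc n))) $ j"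
      by (cases j) (simp_all add: S_def X_def add_ac)
  qed
  have q_r: "(q - inverse q) * r = 1"
    using q_square(1) by (simp add: r_def)
  have "(q - inverse q) *\<^sub>C (S 0 * Y 0 - Y 0 * S 0) = P - k'"
  proof (rule fps_ext)
    fix j
    have "(S 0 * Y 0 - Y 0 * S 0) $ j = r *\<^sub>C (\<phi> Pos (int j) - \<phi> Neg (int j))"
      using xx_commutator[of "int j" 0] by (simp add: S_def Y_def)
    then show "((q - inverse q) *\<^sub>C (S 0 * Y 0 - Y 0 * S 0)) $ j = (P - k') $ j"
      using q_r by (cases j) (simp_all add: scaleC_scaleC scaleC_one phi_series_def \<phi>_zero)
  qed
  then have "q *\<^sub>C (S 0 * Y 0 - Y 0 * S 0) - inverse q *\<^sub>C (S 0 * Y 0 - Y 0 * S 0) = P - k'"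
    by (simp add: cvec.scale_left_diff_distrib)
  from quantum_determinant[OF S dilate_Y this]
  have "qdilate q A * d - zmul (qdilate q (f 0) * e 0) = inverse q *\<^sub>C (qdilate q A * A * P)"
    by (simp add: e_Y_commutator A_k)
  also have "qdilate q A * A * P = k * N"
    using sol unfolding A_solution_def by (metis A_solution_commute(1,4,5) mult.assoc)
  finally show ?thesis .
qed

end

end

section \<open>Algebra homomorphisms applied to coefficients\<close>

lemma fps_map_nth [simp]: "fps_map f F $ n = f (F $ n)"
  by (simp add: fps_map_def)

context
  fixes \<eta> :: "'a::complex_algebra_1 \<Rightarrow> 'b::complex_algebra_1"
  assumes \<eta>: "algebra_hom \<eta>"
begin

lemma algebra_hom_simps:
  "\<eta> (u + v) = \<eta> u + \<eta> v" "\<eta> (c *\<^sub>C u) = c *\<^sub>C \<eta> u" "\<eta> (u * v) = \<eta> u * \<eta> v" "\<eta> 1 = 1"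
  using \<eta> by (simp_all add: algebra_hom_def)

lemma algebra_hom_zero: "\<eta> 0 = 0"
  using algebra_hom_simps(2)[of 0 0] by simp

lemma algebra_hom_diff: "\<eta> (u - v) = \<eta> u - \<eta> v"
  using algebra_hom_simps(1)[of "u - v" v] by (simp add: algebra_simps)

lemma algebra_hom_sum: "\<eta> (\<Sum>i\<in>I. g i) = (\<Sum>i\<in>I. \<eta> (g i))"
  by (induction I rule: infinite_finite_induct) (simp_all add: algebra_hom_zero algebra_hom_simps)

lemma fps_map_hom:
  "fps_map \<eta> (F * G) = fps_map \<eta> F * fps_map \<eta> G"
  "fps_map \<eta> (fps_const u) = fps_const (\<eta> u)"
  "fps_map \<eta> (fps_dilate c F) = fps_dilate c (fps_map \<eta> F)"
  "fps_map \<eta> (fps_scalars N) = fps_scalars N"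
  by (simp_all add: fps_eq_iff fps_mult_nth algebra_hom_sum algebra_hom_simps algebra_hom_zero
      fps_scalars_nth)

end

section \<open>Evaluation of relations\<close>

lemma free_eval_hom: "algebra_hom (free_eval u)"
proof -
  have 1: "free_eval u (Poly_Mapping.single w c) = c *\<^sub>C prod_list (map u (letters w))" for w c
    by (simp add: free_eval_def linear_extension_single)
  have "free_eval u (Poly_Mapping.single w c * p) =
      free_eval u (Poly_Mapping.single w c) * free_eval u p"
    for w c p
    by (induction p rule: poly_mapping_single_induct)
      (simp_all add: mult_single 1 plus_mono_def scaleC_linear scaleC_scaleC distrib_left
        linear_extension_add[of "\<lambda>w. prod_list (map u (letters w))", folded free_eval_def])
  then have "free_eval u (p * p') = free_eval u p * free_eval u p'" for p p'
    by (induction p rule: poly_mapping_single_induct)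
      (simp_all add: distrib_right free_eval_def linear_extension_add)
  moreover have "free_eval u 1 = 1"
    by (simp add: single_one[symmetric] 1 zero_mono_def scaleC_one del: single_one)
  ultimately show ?thesis
    by (simp add: algebra_hom_def free_eval_def linear_extension_add linear_extension_scaleC)
qed

lemma free_eval_gen: "free_eval u (free_gen g) = u g"
  by (simp add: free_eval_def free_gen_def linear_extension_single scaleC_one)

text \<open>Used with the evaluation homomorphism, which thereby carries the relators of the free
  algebra to those of the given elements.\<close>

lemma uq_relators_hom:
  assumes "algebra_hom \<eta>"
  shows "uq_relators q (\<lambda>s m. \<eta> (x s m)) (\<lambda>e m. \<eta> (\<phi> e m)) = \<eta> ` uq_relators q x \<phi>"
proof -
  have one: "\<eta> u - 1 = \<eta> (u - 1)" for u
    by (simp add: algebra_hom_diff[OF assms] algebra_hom_simps[OF assms])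
  show ?thesis
    unfolding uq_relators_def image_Un commutator_def
    unfolding algebra_hom_simps(1-3)[OF assms, symmetric] algebra_hom_diff[OF assms, symmetric] one
    by (intro arg_cong2[where f = "(\<union>)"]; blast)
qed

lemma quantum_affine_algebra_drinfeld:
  assumes "q \<noteq> 0" "\<forall>n::nat. n > 0 \<longrightarrow> q ^ n \<noteq> 1" "quantum_affine_algebra q x \<phi>"
  shows "drinfeld q x \<phi>"
proof
  let ?\<eta> = "free_eval (case_uq_gen x \<phi>)"
  let ?R = "uq_relators q (\<lambda>s m. free_gen (GX s m)) (\<lambda>e m. free_gen (GPhi e m))"
  fix u assume "u \<in> uq_relators q x \<phi>"
  then have "u \<in> ?\<eta> ` ?R"
    by (simp add: free_eval_gen flip: uq_relators_hom[OF free_eval_hom])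
  moreover have "?\<eta> v = 0" if "v \<in> ?R" for v
    using assms(3) generated_ideal.gen[OF that, of 1 1]
    by (auto simp: quantum_affine_algebra_def presented_by_def)
  ultimately show "u = 0" by auto
qed (use assms in auto)

section \<open>Existence and uniqueness of the series\<close>

context drinfeld
begin

lemma \<phi>_inverse': "\<phi> e 0 * \<phi> (opp e) 0 = 1" "\<phi> (opp e) 0 * \<phi> e 0 = 1"
  by (cases e; simp add: \<phi>_inverse)+

text \<open>The definite description is meaningful: multiplying by the inverse of
  \<open>\<phi> e 0\<close> normalizes the equation, whose degree n part then determines the
  coefficient of degree n with factor 1 + c^n, inside the subalgebra.\<close>

lemma A_series_solution:
  assumes N: "normalized_poly_series e a = (fps_scalars N :: 'u fps)" "N $ 0 = 1"
  shows "A_series q \<phi> e a $ 0 = 1 \<and>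
      (\<forall>n. A_series q \<phi> e a $ n \<in> generated_subalgebra {\<phi> s m | s m. True}) \<and>
    phi_series \<phi> e * (A_series q \<phi> e a * fps_dilate (q powi (2 * sign_int e)) (A_series q \<phi> e a)) =
      fps_const (\<phi> e 0) * normalized_poly_series e a"
proof -
  define c where "c = q powi (2 * sign_int e)"
  let ?G = "{\<phi> s m | s m. True}"
  define S where "S = generated_subalgebra ?G"
  note S = phi_in_subalgebra[folded S_def] generated_subalgebra.mult[of _ ?G, folded S_def]
    generated_subalgebra.scale[of _ ?G, folded S_def] generated_subalgebra_zero[of ?G, folded S_def]
    generated_subalgebra.one[of ?G, folded S_def] generated_subalgebra_diff[of _ ?G, folded S_def]
  note S_mult_nth = generated_subalgebra_mult_nth[of _ ?G, folded S_def]
  let ?N = "normalized_poly_series e a :: 'u fps"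
  define Q where "Q = fps_const (\<phi> (opp e) 0) * phi_series \<phi> e"
  have Q0: "Q $ 0 = 1"
    by (simp add: Q_def phi_series_def \<phi>_inverse')
  have N0: "?N $ 0 = 1"
    by (simp add: N fps_scalars_nth scaleC_one)
  have Q_mem: "Q $ n \<in> S" for n
    by (simp add: Q_def phi_series_def S)
  have c: "1 + c ^ n \<noteq> 0" for n
    using one_plus_power[of n] by (cases e) (simp_all add: c_def power_int_minus power2_eq_square)
  have equiv: "phi_series \<phi> e * F = fps_const (\<phi> e 0) * ?N \<longleftrightarrow> Q * F = ?N" for F
  proof
    assume "phi_series \<phi> e * F = fps_const (\<phi> e 0) * ?N"
    then have "Q * F = fps_const (\<phi> (opp e) 0) * (fps_const (\<phi> e 0) * ?N)"
      by (simp add: Q_def mult.assoc)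
    then show "Q * F = ?N"
      by (simp add: \<phi>_inverse' flip: mult.assoc)
  next
    assume "Q * F = ?N"
    then have "fps_const (\<phi> e 0) * ?N = fps_const (\<phi> e 0) * (Q * F)" by simp
    then show "phi_series \<phi> e * F = fps_const (\<phi> e 0) * ?N"
      by (simp add: Q_def \<phi>_inverse' flip: mult.assoc)
  qed
  have "\<exists>F. F $ 0 = 1 \<and> Q * (F * fps_dilate c F) = ?N \<and> (\<forall>n. F $ n \<in> S)"
  proof (rule triangular_equation_exists[where c = "\<lambda>n. 1 + c ^ n"])
    fix F :: "'u fps" and n
    assume "\<And>i. i < n \<Longrightarrow> F $ i \<in> S"
    then have "fps_cutoff n F $ i \<in> S" for i
      by (simp add: S)
    then have "(Q * (fps_cutoff n F * fps_dilate c (fps_cutoff n F))) $ n \<in> S"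
      by (intro S_mult_nth Q_mem) (simp_all add: S del: fps_cutoff_nth)
    then show "inverse (1 + c ^ n) *\<^sub>C
        (?N $ n - (Q * (fps_cutoff n F * fps_dilate c (fps_cutoff n F))) $ n) \<in> S"
      by (intro S) (simp_all add: N fps_scalars_nth S)
  qed (use c Q0 N0 dilation_square_triangular in \<open>auto simp: scaleC_one S\<close>)
  moreover have "F = G" if "F $ 0 = 1 \<and> (\<forall>n. F $ n \<in> S) \<and> Q * (F * fps_dilate c F) = ?N"
    "G $ 0 = 1 \<and> (\<forall>n. G $ n \<in> S) \<and> Q * (G * fps_dilate c G) = ?N" for F G
    by (rule triangular_equation_unique[where \<Phi> = "\<lambda>F. Q * (F * fps_dilate c F)"
          and c = "\<lambda>n. 1 + c ^ n" and ?a0.0 = 1])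
      (use c Q0 that dilation_square_triangular in auto)
  ultimately have "\<exists>!F. F $ 0 = 1 \<and> (\<forall>n. F $ n \<in> S) \<and> Q * (F * fps_dilate c F) = ?N"
    by blast
  from theI'[OF this] show ?thesis
    unfolding A_series_def c_def[symmetric] S_def[symmetric] equiv .
qed

text \<open>The series of the h_s exists uniquely by the triangular argument, and degree 1 of the
  exponential formula is the claim. It moves the given coproduct values to \<phi>^-_0 \<phi>^+_1 and
  \<phi>^+_0 \<phi>^-_{-1}.\<close>

lemma h_elem_\<phi>:
  "\<phi> Pos 1 = \<phi> Pos 0 * ((q - inverse q) *\<^sub>C h_elem q \<phi> 1)"
  "\<phi> Neg (- 1) = - (\<phi> Neg 0 * ((q - inverse q) *\<^sub>C h_elem q \<phi> (- 1)))"
proof -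
  have *: "\<phi> e (sign_int e) = \<phi> e 0 * ((of_int (sign_int e) * (q
      - inverse q)) *\<^sub>C (h_series q \<phi> e $ 1))"
    for e
  proof -
    define c where "c = of_int (sign_int e) * (q - inverse q)"
    have c: "c \<noteq> 0" using q_square(1) by (cases e) (auto simp: c_def)
    define M where "M = fps_const (\<phi> (opp e) 0) * phi_series \<phi> e"
    have M0: "M $ 0 = 1"
      by (simp add: M_def phi_series_def \<phi>_inverse')
    have equiv: "phi_series \<phi> e = fps_const (\<phi> e 0) * F \<longleftrightarrow> F = M" for F
    proof
      assume "phi_series \<phi> e = fps_const (\<phi> e 0) * F"
      then show "F = M"
        by (simp add: M_def \<phi>_inverse' flip: mult.assoc)
    next
      assume "F = M"
      then show "phi_series \<phi> e = fps_const (\<phi> e 0) * F"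
        by (simp add: M_def \<phi>_inverse' flip: mult.assoc)
    qed
    have base: "fps_exponential (fps_scalar c * F) $ 0 = 1" for F :: "'u fps"
      by (simp add: fps_exponential_def scaleC_one)
    have "\<exists>F. F $ 0 = 0 \<and> fps_exponential (fps_scalar c * F) = M \<and> (\<forall>n::nat. True)"
      by (rule triangular_equation_exists[where c = "\<lambda>_. c" and P = "\<lambda>_. True"])
        (use c base M0 exponential_triangular in auto)
    moreover have "F = G" if "F $ 0 = 0 \<and> fps_exponential (fps_scalar c * F) = M"
      "G $ 0 = 0 \<and> fps_exponential (fps_scalar c * G) = M" for F G
      by (rule triangular_equation_unique[where c = "\<lambda>_. c" and \<Phi> =
          "\<lambda>F. fps_exponential (fps_scalar c * F)"
          and ?a0.0 = 0]) (use c that exponential_triangular in auto)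
    ultimately have "\<exists>!F. F $ 0 = 0 \<and> fps_exponential (fps_scalar c * F) = M"
      by blast
    then have "\<exists>!F. F $ 0 = 0 \<and> phi_series \<phi> e =
        fps_const (\<phi> e 0) * fps_exponential (fps_scalar c * F)"
      unfolding equiv .
    from theI'[OF this] have "phi_series \<phi> e = fps_const (\<phi> e 0) *
        fps_exponential (fps_scalar c * h_series q \<phi> e)"
      unfolding h_series_def c_def[symmetric] by blast
    from arg_cong[OF this, of "\<lambda>F. F $ 1"]
    show ?thesis
      by (simp add: phi_series_def fps_exponential_def fps_scalar_mult scaleC_one flip: c_def)
  qed
  show "\<phi> Pos 1 = \<phi> Pos 0 * ((q - inverse q) *\<^sub>C h_elem q \<phi> 1)"
    using *[of Pos] by (simp add: h_elem_def)
  show "\<phi> Neg (- 1) = - (\<phi> Neg 0 * ((q - inverse q) *\<^sub>C h_elem q \<phi> (- 1)))"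
    using *[of Neg] by (simp add: h_elem_def scaleC_linear cvec.scale_left_diff_distrib algebra_simps)
qed

end

section \<open>The coproduct\<close>

definition fps_pairing :: "('a \<Rightarrow> 'b \<Rightarrow> 'c::comm_monoid_add) \<Rightarrow> 'a fps \<Rightarrow> 'b fps \<Rightarrow> 'c fps" where
  "fps_pairing T F G = Abs_fps (\<lambda>n. \<Sum>i\<le>n. T (F $ i) (G $ (n - i)))"

text \<open>
  The target of the coproduct is abstracted to an algebra with a multiplicative bilinear map,
  so that the tensor factors can be exchanged.
\<close>

locale coproduct = drinfeld q x \<phi>
  for q and x \<phi> :: "sign \<Rightarrow> int \<Rightarrow> 'u::complex_algebra_1" +
  fixes T :: "'u \<Rightarrow> 'u \<Rightarrow> 'v::complex_algebra_1" and \<Delta> :: "'u \<Rightarrow> 'v"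
  assumes T_add: "T (u + u') v = T u v + T u' v" "T u (v + v') = T u v + T u v'"
    and T_scale: "T (c *\<^sub>C u) v = c *\<^sub>C T u v" "T u (c *\<^sub>C v) = c *\<^sub>C T u v"
    and T_mult: "T u v * T u' v' = T (u * u') (v * v')"
    and T_one: "T 1 1 = 1"
    and \<Delta>_hom: "algebra_hom \<Delta>"
    and \<Delta>_x: "\<Delta> (x Pos 0) = T (x Pos 0) 1 + T (\<phi> Pos 0) (x Pos 0)"
      "\<Delta> (x Neg 0) = T 1 (x Neg 0) + T (x Neg 0) (\<phi> Neg 0)"
    and \<Delta>_\<phi>: "\<Delta> (\<phi> e 0) = T (\<phi> e 0) (\<phi> e 0)"
    and \<Delta>_h: "\<Delta> (\<phi> Neg 0 * \<phi> Pos 1) = T (\<phi> Neg 0 * \<phi> Pos 1) 1 + T 1 (\<phi> Neg 0 * \<phi> Pos 1)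
        - ((q - inverse q) * (q * q - inverse q * inverse q)) *\<^sub>C T (x Neg 1) (x Pos 0)"
      "\<Delta> (\<phi> Pos 0 * \<phi> Neg (- 1)) = T (\<phi> Pos 0 * \<phi> Neg (- 1)) 1 + T 1 (\<phi> Pos 0 * \<phi> Neg (- 1))
        - ((q - inverse q) * (q * q - inverse q * inverse q)) *\<^sub>C T (x Neg 0) (x Pos (- 1))"

section \<open>Shifting modes by h_1 and h_{-1}\<close>

context drinfeld
begin

text \<open>\<phi>^-_0 \<phi>^+_1 is (q - q^-1) h_1. Both formulas are the relation of \<phi>^+ with
  the currents at m = 0, multiplied by \<phi>^-_0.\<close>

lemma h_x:
  "\<phi> Neg 0 * \<phi> Pos 1 * x Pos n =
    x Pos n * (\<phi> Neg 0 * \<phi> Pos 1) + (q * q - inverse q * inverse q) *\<^sub>C x Pos (n + 1)"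
  "\<phi> Neg 0 * \<phi> Pos 1 * x Neg n =
    x Neg n * (\<phi> Neg 0 * \<phi> Pos 1) - (q * q - inverse q * inverse q) *\<^sub>C x Neg (n + 1)"
proof -
  have k'_x: "\<phi> Neg 0 * x Pos n = inverse q *\<^sub>C inverse q *\<^sub>C (x Pos n * \<phi> Neg 0)"
    "\<phi> Neg 0 * x Neg n = q *\<^sub>C q *\<^sub>C (x Neg n * \<phi> Neg 0)" for n
    by (simp_all add: k'_x' q_cancel)
  have scale: "(q * q - inverse q * inverse q) *\<^sub>C w = q *\<^sub>C q *\<^sub>C w
      - inverse q *\<^sub>C inverse q *\<^sub>C w" for w :: 'u
    by (simp add: cvec.scale_left_diff_distrib scaleC_scaleC)
  have "\<phi> Pos 1 * x Pos n = q *\<^sub>C q *\<^sub>C (\<phi> Pos 0 * x Pos (n + 1)) +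
      (q *\<^sub>C q *\<^sub>C (x Pos n * \<phi> Pos 1) - x Pos (n + 1) * \<phi> Pos 0)"
    using \<phi>_x'(1)[of Pos 0 n] by (simp add: algebra_simps)
  then show "\<phi> Neg 0 * \<phi> Pos 1 * x Pos n =
    x Pos n * (\<phi> Neg 0 * \<phi> Pos 1) + (q * q - inverse q * inverse q) *\<^sub>C x Pos (n + 1)"
    unfolding scale
    by (simp add: mult.assoc expand k'_x mult_assoc_rule[OF k'_x(1)] q_cancel \<phi>_inverse
        mult_assoc_rule[OF \<phi>_inverse(2)])
  have "\<phi> Pos 1 * x Neg n = inverse q *\<^sub>C inverse q *\<^sub>C (\<phi> Pos 0 * x Neg (n + 1)) +
      (inverse q *\<^sub>C inverse q *\<^sub>C (x Neg n * \<phi> Pos 1) - x Neg (n + 1) * \<phi> Pos 0)"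
    using \<phi>_x'(2)[of Pos 0 n] by (simp add: algebra_simps)
  then show "\<phi> Neg 0 * \<phi> Pos 1 * x Neg n =
    x Neg n * (\<phi> Neg 0 * \<phi> Pos 1) - (q * q - inverse q * inverse q) *\<^sub>C x Neg (n + 1)"
    unfolding scale
    by (simp add: mult.assoc expand k'_x mult_assoc_rule[OF k'_x(2)] q_cancel \<phi>_inverse
        mult_assoc_rule[OF \<phi>_inverse(2)])
qed

end

context coproduct
begin

text \<open>Reversal exchanges the given values at x^+_0 and x^-_0, at \<phi>^+_0 and \<phi>^-_0,
  and at the two h elements, once the tensor factors are flipped.\<close>

lemma coproduct_opp: "coproduct q (\<lambda>s m. x (opp s) (- m)) (\<lambda>e m. \<phi> (opp e) (- m)) (\<lambda>u v. T v u) \<Delta>"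
proof -
  interpret o: drinfeld q "\<lambda>s m. x (opp s) (- m)" "\<lambda>e m. \<phi> (opp e) (- m)"
    by (rule drinfeld_opp)
  show ?thesis
    by unfold_locales
      (simp_all add: T_add T_scale T_mult T_one \<Delta>_hom \<Delta>_x \<Delta>_\<phi> \<Delta>_h add.commute)
qed

lemmas \<Delta>_simps = algebra_hom_simps[OF \<Delta>_hom] algebra_hom_diff[OF \<Delta>_hom] algebra_hom_zero[OF \<Delta>_hom]

lemma T_diff: "T (u - u') v = T u v - T u' v" "T u (v - v') = T u v - T u v'"
  by (metis add_diff_cancel diff_add_cancel T_add)+

lemmas T_linear = T_add T_diff T_scale T_mult

text \<open>Up to a nonzero scalar x^+_{-1} is the commutator of h_{-1} and x^+_0, whose coproducts
  are given. The commutator of x^-_0 with x^+_0 from the correction term turns \<phi>^+_0 into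
  \<phi>^-_0 in the second summand.\<close>

lemma \<Delta>_x_minus_one: "\<Delta> (x Pos (- 1)) = T (x Pos (- 1)) 1 + T (\<phi> Neg 0) (x Pos (- 1))"
proof -
  interpret o: drinfeld q "\<lambda>s m. x (opp s) (- m)" "\<lambda>e m. \<phi> (opp e) (- m)"
    by (rule drinfeld_opp)
  define c where "c = q * q - inverse q * inverse q"
  define s where "s = (q - inverse q) * c"
  define h where "h = \<phi> Pos 0 * \<phi> Neg (- 1)"
  have h_x: "h * x Pos 0 = x Pos 0 * h - c *\<^sub>C x Pos (- 1)"
    using o.h_x(2)[of 0] by (simp add: h_def c_def)
  have h_k: "h * \<phi> Pos 0 = \<phi> Pos 0 * h"
    unfolding h_def by (metis \<phi>_commute mult.assoc)
  have x_y: "x Neg 0 * x Pos 0 = x Pos 0 * x Neg 0 - r *\<^sub>C (\<phi> Pos 0 - \<phi> Neg 0)"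
    using xx_commutator[of 0 0] by (simp add: algebra_simps)
  have x_x: "x Pos 0 * x Pos (- 1) = q *\<^sub>C q *\<^sub>C (x Pos (- 1) * x Pos 0)"
    using x_x'(1)[of "- 1"] by simp
  have y_k: "x Neg 0 * \<phi> Pos 0 = q *\<^sub>C q *\<^sub>C (\<phi> Pos 0 * x Neg 0)"
    by (simp add: k_x' q_cancel)
  have sr: "s *\<^sub>C r *\<^sub>C w = c *\<^sub>C w" for w :: 'v
    using q_square(1) by (simp add: s_def r_def scaleC_scaleC)
  have "- (c *\<^sub>C \<Delta> (x Pos (- 1))) = \<Delta> h * \<Delta> (x Pos 0) - \<Delta> (x Pos 0) * \<Delta> h"
    using arg_cong[OF h_x, of \<Delta>] by (simp add: \<Delta>_simps)
  also have "\<dots> = - (c *\<^sub>C (T (x Pos (- 1)) 1 + T (\<phi> Neg 0) (x Pos (- 1))))"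
    unfolding \<Delta>_x \<Delta>_h(2)[folded h_def c_def, folded s_def]
    by (simp add: expand T_linear h_x h_k x_y x_x y_k sr)
  finally show ?thesis
    using q_square(2) by (simp add: c_def)
qed

lemma \<Delta>_y_one: "\<Delta> (x Neg 1) = T 1 (x Neg 1) + T (x Neg 1) (\<phi> Pos 0)"
proof -
  interpret o: coproduct q "\<lambda>s m. x (opp s) (- m)" "\<lambda>e m. \<phi> (opp e) (- m)" "\<lambda>u v. T v u" \<Delta>
    by (rule coproduct_opp)
  show ?thesis using o.\<Delta>_x_minus_one by simp
qed

section \<open>Tensor products of series\<close>

definition tens :: "'u fps \<Rightarrow> 'u fps \<Rightarrow> 'v fps" where
  "tens = fps_pairing T"

lemma tens_eq_mult: "tens F G = fps_map (\<lambda>u. T u 1) F * fps_map (T 1) G"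
  by (simp add: fps_eq_iff tens_def fps_pairing_def fps_mult_nth T_mult atLeast0AtMost)

lemma tens_mult: "tens F G * tens F' G' = tens (F * F') (G * G')"
proof -
  have hom: "algebra_hom (\<lambda>u. T u 1)" "algebra_hom (T 1)"
    by (simp_all add: algebra_hom_def T_add T_scale T_mult T_one)
  have "fps_map (T 1) G * fps_map (\<lambda>u. T u 1) F' = fps_map (\<lambda>u. T u 1) F' * fps_map (T 1) G"
    by (rule fps_mult_commute_coeffs) (simp add: T_mult)
  from mult_assoc_rule[OF this] show ?thesis
    by (simp add: tens_eq_mult fps_map_hom(1)[OF hom(1)] fps_map_hom(1)[OF hom(2)] mult.assoc)
qed

lemma tens_linear:
  "tens (F + F') G = tens F G + tens F' G" "tens F (G + G') = tens F G + tens F G'"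
  "tens (c *\<^sub>C F) G = c *\<^sub>C tens F G" "tens F (c *\<^sub>C G) = c *\<^sub>C tens F G"
  "tens (zmul F) G = zmul (tens F G)" "tens F (zmul G) = zmul (tens F G)"
proof -
  have T0: "T 0 v = 0" "T v 0 = 0" for v
    using T_scale(1)[of 0 0 v] T_scale(2)[of v 0 0] by simp_all
  have map: "fps_map (\<lambda>u. T u 1) (F + F') = fps_map (\<lambda>u. T u 1) F + fps_map (\<lambda>u. T u 1) F'"
    "fps_map (T 1) (G + G') = fps_map (T 1) G + fps_map (T 1) G'"
    "fps_map (\<lambda>u. T u 1) (c *\<^sub>C F) = c *\<^sub>C fps_map (\<lambda>u. T u 1) F"
    "fps_map (T 1) (c *\<^sub>C G) = c *\<^sub>C fps_map (T 1) G"
    "fps_map (\<lambda>u. T u 1) (zmul F) = zmul (fps_map (\<lambda>u. T u 1) F)"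
    "fps_map (T 1) (zmul G) = zmul (fps_map (T 1) G)"
    by (auto simp: fps_eq_iff T_add T_scale T0)
  show "tens (F + F') G = tens F G + tens F' G" "tens F (G + G') = tens F G + tens F G'"
    "tens (c *\<^sub>C F) G = c *\<^sub>C tens F G" "tens F (c *\<^sub>C G) = c *\<^sub>C tens F G"
    "tens (zmul F) G = zmul (tens F G)" "tens F (zmul G) = zmul (tens F G)"
    by (simp_all add: tens_eq_mult map expand)
qed

lemma tens_dilate: "fps_dilate c (tens F G) = tens (fps_dilate c F) (fps_dilate c G)"
proof -
  have "fps_dilate c (fps_map (\<lambda>u. T u 1) F) = fps_map (\<lambda>u. T u 1) (fps_dilate c F)"
    "fps_dilate c (fps_map (T 1) G) = fps_map (T 1) (fps_dilate c G)"
    by (simp_all add: fps_eq_iff T_scale)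
  then show ?thesis by (simp add: tens_eq_mult fps_dilate_mult)
qed

lemma tens_const: "tens (fps_const u) (fps_const v) = fps_const (T u v)"
proof -
  have T0: "T 0 v = 0" "T v 0 = 0" for v
    using T_scale(1)[of 0 0 v] T_scale(2)[of v 0 0] by simp_all
  have "fps_map (\<lambda>u. T u 1) (fps_const u) = fps_const (T u 1)"
    "fps_map (T 1) (fps_const v) = fps_const (T 1 v)"
    by (simp_all add: fps_eq_iff T0)
  then show ?thesis by (simp add: tens_eq_mult T_mult)
qed

lemma tens_scalars: "tens (fps_scalars N) (fps_scalars M) = fps_scalars (N * M)"
proof -
  have "fps_map (\<lambda>u. T u 1) (fps_scalars N) = fps_scalars N"
    "fps_map (T 1) (fps_scalars M) = fps_scalars M"
    by (simp_all add: fps_eq_iff fps_scalars_nth T_scale T_one)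
  moreover have "(c *\<^sub>C 1) * (d *\<^sub>C 1) = (c * d) *\<^sub>C (1 :: 'v)" for c d
    by (simp add: mult_scaleC_left scaleC_scaleC)
  ultimately show ?thesis
    by (simp add: tens_eq_mult fps_eq_iff fps_mult_nth fps_scalars_nth cvec.scale_sum_left)
qed

text \<open>R and \<Delta>(C) solve the same equation W'' W \<Delta>(\<phi>^+(z)) = \<Delta>(k N M).
  As R is not known to have coefficients in a commutative subalgebra, uniqueness comes from the
  Sylvester argument.\<close>

lemma coproduct_A_solution:
  assumes A: "A_solution (fps_scalars N) A" "N $ 0 = 1"
    and B: "A_solution (fps_scalars M) B" "M $ 0 = 1"
    and C: "A_solution (fps_scalars (N * M)) C"
  shows "fps_map \<Delta> C = tens A B + zmul (q *\<^sub>C tens (qbracket q A (Y 1)) (qbracket q (X 1) B))"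
proof -
  let ?n = "fps_scalars N :: 'u fps" and ?m = "fps_scalars M :: 'u fps"
  let ?nm = "fps_scalars (N * M) :: 'u fps"
  have n: "?n $ 0 = 1" "?m $ 0 = 1" "?nm $ 0 = 1"
    using A B by (simp_all add: fps_scalars_nth scaleC_one)
  note com = fps_scalars_commute[where ?'a = 'u]
  define h where "h = \<phi> Neg 0 * \<phi> Pos 1"
  have one: "(1 :: 'u fps) = fps_const 1" by simp
  interpret A: lax q X Y A k k' "fps_const (\<phi> Neg (- 1))" "fps_const (r *\<^sub>C \<phi> Pos 1)" r
    by (rule A_solution_lax[OF A(1) com n(1)])
  interpret B: lax q X Y B k k' "fps_const (\<phi> Neg (- 1))" "fps_const (r *\<^sub>C \<phi> Pos 1)" r
    by (rule A_solution_lax[OF B(1) com n(2)])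
  interpret lax_tensor q X Y A B k k' "fps_const (\<phi> Neg (- 1))" "fps_const (r *\<^sub>C \<phi> Pos 1)" r tens
    "\<lambda>n. fps_const (\<Delta> (x Pos (int n - 1)))" "\<lambda>n. fps_const (\<Delta> (x Neg (int n)))"
    "fps_const (\<Delta> h)" "fps_const h"
  proof (unfold_locales)
    show "tens F G * tens F' G' = tens (F * F') (G * G')" for F G F' G'
      by (rule tens_mult)
    show "qdilate q (tens F G) = tens (qdilate q F) (qdilate q G)" for F G
      by (rule tens_dilate)
    show "fps_const (\<Delta> (x Pos (int 0 - 1))) = tens (X 0) 1 + tens k' (X 0)"
      "fps_const (\<Delta> (x Pos (int 1 - 1))) = tens (X 1) 1 + tens k (X 1)"
      "fps_const (\<Delta> (x Neg (int 0))) = tens 1 (Y 0) + tens (Y 0) k'"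
      "fps_const (\<Delta> (x Neg (int 1))) = tens 1 (Y 1) + tens (Y 1) k"
      unfolding one by (simp_all only: X_def Y_def tens_const)
        (simp_all add: \<Delta>_x \<Delta>_x_minus_one \<Delta>_y_one)
    show "fps_const h * A = A * fps_const h" "fps_const h * B = B * fps_const h"
      using A_solution_commute(2)[OF A(1) com n(1)] A_solution_commute(2)[OF B(1) com n(2)]
      unfolding h_def fps_const_mult[symmetric] by (metis mult.assoc)+
    show "fps_const h * X n = X n * fps_const h + (q * q - inverse q * inverse q) *\<^sub>C X (Suc n)"
        for n
      using h_x(1)[of "int n - 1"] by (simp add: X_def h_def flip: fps_const_scaleC)
    show "fps_const h * Y n = Y n * fps_const h - (q * q - inverse q * inverse q) *\<^sub>C Y (Suc n)"
        for n
      using h_x(2)[of "int n"] by (simp add: Y_def h_def add.commute flip: fps_const_scaleC)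
    show "fps_const (\<Delta> h) = tens (fps_const h) 1 + tens 1 (fps_const h) -
        ((q - inverse q) * (q * q - inverse q * inverse q)) *\<^sub>C tens (Y 1) (X 1)"
      unfolding one by (simp only: X_def Y_def tens_const)
        (simp add: h_def \<Delta>_h flip: fps_const_scaleC)
    show "fps_const (\<Delta> h) * fps_const (\<Delta> (x Pos (int n - 1))) =
        fps_const (\<Delta> (x Pos (int n - 1))) * fps_const (\<Delta> h) +
        (q * q - inverse q * inverse q) *\<^sub>C fps_const (\<Delta> (x Pos (int (Suc n) - 1)))" for n
      using arg_cong[OF h_x(1)[of "int n - 1", folded h_def], of \<Delta>]
      by (simp add: \<Delta>_simps flip: fps_const_scaleC)
    show "fps_const (\<Delta> h) * fps_const (\<Delta> (x Neg (int n))) =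
        fps_const (\<Delta> (x Neg (int n))) * fps_const (\<Delta> h) -
        (q * q - inverse q * inverse q) *\<^sub>C fps_const (\<Delta> (x Neg (int (Suc n))))" for n
      using arg_cong[OF h_x(2)[of "int n", folded h_def], of \<Delta>]
      by (simp add: \<Delta>_simps add.commute flip: fps_const_scaleC)
    show "q * q - inverse q * inverse q \<noteq> 0" by (fact q_square)
  qed (fact tens_linear)+
  let ?P = "fps_map \<Delta> P"
  let ?k' = "tens k' k'"
  have k': "fps_const (\<Delta> (\<phi> Neg 0)) = ?k'"
    by (simp add: tens_const \<Delta>_\<phi>)
  define S where "S n = Abs_fps (\<lambda>i. \<Delta> (x Pos (int n + int i)))" for n
  have S: "S n = fps_const (\<Delta> (x Pos (int (Suc n) - 1))) + zmul (S (Suc n))" for n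
  proof (rule fps_ext)
    fix j
    show "S n $ j = (fps_const (\<Delta> (x Pos (int (Suc n) - 1))) + zmul (S (Suc n))) $ j"
      by (cases j) (simp_all add: S_def add_ac)
  qed
  have "(q - inverse q) *\<^sub>C (S 0 * fps_const (\<Delta> (x Neg (int 0)))
      - fps_const (\<Delta> (x Neg (int 0))) * S 0)
      = ?P - ?k'"
  proof (rule fps_ext)
    fix j
    have q_r: "(q - inverse q) * r = 1"
      using q_square(1) by (simp add: r_def)
    have "(S 0 * fps_const (\<Delta> (x Neg (int 0))) - fps_const (\<Delta> (x Neg (int 0))) * S 0) $ j
        = r *\<^sub>C (\<Delta> (\<phi> Pos (int j)) - \<Delta> (\<phi> Neg (int j)))"
      using arg_cong[OF xx_commutator[of "int j" 0], of \<Delta>] by (simp add: S_def \<Delta>_simps)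
    then show "((q - inverse q) *\<^sub>C (S 0 * fps_const (\<Delta> (x Neg (int 0))) -
        fps_const (\<Delta> (x Neg (int 0))) * S 0)) $ j = (?P - ?k') $ j"
      unfolding k'[symmetric] using q_r
      by (cases j) (simp_all add: scaleC_scaleC scaleC_one phi_series_def \<phi>_zero \<Delta>_simps)
  qed
  then have S_comm: "q *\<^sub>C (S 0 * fps_const (\<Delta> (x Neg (int 0)))
      - fps_const (\<Delta> (x Neg (int 0))) * S 0)
      - inverse q *\<^sub>C (S 0 * fps_const (\<Delta> (x Neg (int 0))) - fps_const (\<Delta> (x Neg (int 0))) * S 0)
      = ?P - ?k'"
    by (simp add: cvec.scale_left_diff_distrib)
  \<comment> \<open>The determinant of R is evaluated twice: by the exchange relations, and as the
    product of the determinants of A and B.\<close>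
  have "inverse q *\<^sub>C (qdilate q R * R * ?P) = inverse q *\<^sub>C tens (k * ?n) (k * ?m)"
    unfolding RV.quantum_determinant[OF S fps_dilate_linear(5) S_comm, symmetric]
    using A_solution_determinant[OF A(1) com n(1)] A_solution_determinant[OF B(1) com n(2)]
    by (intro determinant_R) (simp_all add: A.e_def A.f_def B.e_def B.f_def com)
  then have "qdilate q R * R * ?P = tens (k * ?n) (k * ?m)"
    using q_nonzero by simp
  also have "\<dots> = fps_map \<Delta> (k * ?nm)"
    by (simp add: fps_map_hom[OF \<Delta>_hom] \<Delta>_\<phi> tens_scalars flip: tens_mult tens_const)
  also have "\<dots> = fps_map \<Delta> (qdilate q C * C * P)"
    using C unfolding A_solution_def by (metis A_solution_commute(1,4,5)[OF C com n(3)] mult.assoc)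
  also have "\<dots> = qdilate q (fps_map \<Delta> C) * fps_map \<Delta> C * ?P"
    by (simp add: fps_map_hom[OF \<Delta>_hom])
  \<comment> \<open>The extra factor \<Delta>(\<phi>^-_0) gives the series to be cancelled the
    constant term 1.\<close>
  finally have "(qdilate q R * R
      - qdilate q (fps_map \<Delta> C) * fps_map \<Delta> C) * (?P * fps_const (\<Delta> (\<phi> Neg 0))) = 0"
    by (simp add: left_diff_distrib flip: mult.assoc)
  then have "qdilate q R * R - qdilate q (fps_map \<Delta> C) * fps_map \<Delta> C = 0"
    by (rule mult_eq_zero_lowest) (simp add: phi_series_def \<phi>_inverse \<Delta>_simps(4) flip: \<Delta>_simps(3))
  \<comment> \<open>a'' a - b'' b = a'' (a - b) + (a - b)'' b, an equation of Sylvester type for a -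
    b.\<close>
  then have zero: "qdilate q R * (R - fps_map \<Delta> C) + qdilate q (R - fps_map \<Delta> C) * fps_map \<Delta> C = 0"
    by (simp add: fps_dilate_linear algebra_simps)
  have "R $ 0 = 1" and ones: "qdilate q R $ 0 = 1" "fps_map \<Delta> C $ 0 = 1"
    using A B C
    unfolding R_def by (simp_all add: tens_def fps_pairing_def A_solution_def T_one \<Delta>_simps scaleC_one)
  have "R - fps_map \<Delta> C = 0"
    using ones zero one_plus_power(1) by (rule sylvester_zero_left)
  then show ?thesis
    by (simp add: R_def A.f_def B.e_def)
qed

end

section \<open>The two formulas\<close>

fun normalized_fps :: "sign \<Rightarrow> complex poly \<Rightarrow> complex fps" where
  "normalized_fps Pos a = fps_of_poly (smult (inverse (coeff a 0)) a)"
| "normalized_fps Neg a = fps_of_poly (smult (inverse (lead_coeff a)) (reflect_poly a))"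

lemma normalized_poly_series_eq: "normalized_poly_series e a = fps_scalars (normalized_fps e a)"
  by (cases e) (simp_all add: fps_scalars_def)

lemma normalized_fps_nth_0: "coeff a 0 \<noteq> 0 \<Longrightarrow> normalized_fps e a $ 0 = 1"
  by (cases e; cases "a = 0") simp_all

lemma normalized_fps_mult: "normalized_fps e (a * b) = normalized_fps e a * normalized_fps e b"
  by (cases e) (simp_all add: coeff_mult_0 lead_coeff_mult reflect_poly_mult fps_of_poly_smult
      fps_of_poly_mult mult_ac flip: fps_const_mult)

text \<open>Each commutator in the theorem is the indeterminate times a q-bracket, so dividing their
  tensor product by the indeterminate leaves the single factor of the computed formula.\<close>

lemma fps_to_fls_add_zmul:
  "fps_to_fls (G + zmul (c *\<^sub>C W)) =
    fps_to_fls G + fls_const (c *\<^sub>C 1) * fls_X_inv * fps_to_fls (zmul (zmul W))"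
proof -
  have "fls_const (c *\<^sub>C 1) * fls_X_inv * fps_to_fls (zmul (zmul W)) = fps_to_fls (zmul (c *\<^sub>C W))"
  proof (rule fls_eqI)
    fix n
    show "fls_nth (fls_const (c *\<^sub>C 1) * fls_X_inv * fps_to_fls (zmul (zmul W))) n =
        fls_nth (fps_to_fls (zmul (c *\<^sub>C W))) n"
      unfolding mult.assoc fls_X_inv_times_conv_shift(1)
      by (cases "n < 0"; cases "n = 0") (auto simp: mult_scaleC_left nat_add_distrib)
  qed
  then show ?thesis by simp
qed

theorem theorem17:
  fixes q :: complex
    and x \<phi> :: "sign \<Rightarrow> int \<Rightarrow> 'u::complex_algebra_1"
    and \<Delta> :: "'u \<Rightarrow> ('u, 'u) tensor"
    and a b :: "complex poly"
  assumes "q \<noteq> 0" and "\<forall>n::nat. n > 0 \<longrightarrow> q ^ n \<noteq> 1"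
    and "quantum_affine_algebra q x \<phi>"
    and "quantum_affine_coproduct q x \<phi> \<Delta>"
    and "even (degree a)" and "coeff a 0 \<noteq> 0"
    and "even (degree b)" and "coeff b 0 \<noteq> 0"
  shows
    "fps_to_fls (fps_map \<Delta> (A_series q \<phi> Neg (a * b))) =
       fps_to_fls (fps_tensor (A_series q \<phi> Neg a) (A_series q \<phi> Neg b))
       + fls_const (inverse q *\<^sub>C 1) * fls_X_inv *
         fps_to_fls (fps_tensor
           (commutator (A_series q \<phi> Neg a) (fps_const (x Neg 1)))
           (commutator (fps_const (x Pos 0)) (A_series q \<phi> Neg b))) \<and>
     fps_to_fls (fps_map \<Delta> (A_series q \<phi> Pos (a * b))) =
       fps_to_fls (fps_tensor (A_series q \<phi> Pos a) (A_series q \<phi> Pos b))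
       + fls_const (q *\<^sub>C 1) * fls_X_inv *
         fps_to_fls (fps_tensor
           (commutator (A_series q \<phi> Pos a) (fps_const (x Neg 0)))
           (commutator (fps_const (x Pos (-1))) (A_series q \<phi> Pos b)))"
proof -
  interpret D: drinfeld q x \<phi>
    using assms(1-3) by (rule quantum_affine_algebra_drinfeld)
  have hom: "algebra_hom \<Delta>"
    using assms(4) by (simp add: quantum_affine_coproduct_def)
  note \<Delta>_simps = algebra_hom_simps[OF hom] algebra_hom_diff[OF hom] algebra_hom_zero[OF hom]
  let ?c = "q * q - inverse q * inverse q"
  have \<Delta>_h: "\<Delta> (h_elem q \<phi> (-1)) = 1 \<otimes>\<^sub>C h_elem q \<phi> (-1) + h_elem q \<phi> (-1) \<otimes>\<^sub>C 1
      + ?c *\<^sub>C (x Neg 0 \<otimes>\<^sub>C x Pos (-1))"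
    "\<Delta> (h_elem q \<phi> 1) = 1 \<otimes>\<^sub>C h_elem q \<phi> 1 + h_elem q \<phi> 1 \<otimes>\<^sub>C 1
      - ?c *\<^sub>C (x Neg 1 \<otimes>\<^sub>C x Pos 0)"
    using assms(4) D.q_powi by (simp_all add: quantum_affine_coproduct_def)
  have h: "\<phi> Neg 0 * \<phi> Pos 1 = (q - inverse q) *\<^sub>C h_elem q \<phi> 1"
    "\<phi> Pos 0 * \<phi> Neg (- 1) = - ((q - inverse q) *\<^sub>C h_elem q \<phi> (- 1))"
    by (simp_all add: D.h_elem_\<phi> D.\<phi>_inverse flip: mult.assoc)
  have minus: "\<Delta> (- u) = - \<Delta> u" "(- u) \<otimes>\<^sub>C v = - (u \<otimes>\<^sub>C v)" "v \<otimes>\<^sub>C (- u) = - (v \<otimes>\<^sub>C u)"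
      for u v :: 'u
    using \<Delta>_simps(2)[of "- 1" u] tensor_pure_bilinear(3)[of "- 1" u v] tensor_pure_bilinear(4)[of v "- 1" u]
    by simp_all
  interpret C: coproduct q x \<phi> "(\<otimes>\<^sub>C)" \<Delta>
  proof unfold_locales
    show "\<Delta> (\<phi> Neg 0 * \<phi> Pos 1) = (\<phi> Neg 0 * \<phi> Pos 1) \<otimes>\<^sub>C 1 + 1 \<otimes>\<^sub>C (\<phi> Neg 0 * \<phi> Pos 1)
        - ((q - inverse q) * ?c) *\<^sub>C (x Neg 1 \<otimes>\<^sub>C x Pos 0)"
      "\<Delta> (\<phi> Pos 0 * \<phi> Neg (- 1)) = (\<phi> Pos 0 * \<phi> Neg (- 1)) \<otimes>\<^sub>C 1 + 1 \<otimes>\<^sub>C (\<phi> Pos 0 * \<phi> Neg (- 1))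
        - ((q - inverse q) * ?c) *\<^sub>C (x Neg 0 \<otimes>\<^sub>C x Pos (- 1))"
      unfolding h
      by (simp_all add: minus \<Delta>_simps(2) \<Delta>_h tensor_pure_bilinear scaleC_linear
          flip: scaleC_scaleC)
  qed (use assms(4) in \<open>simp_all add: quantum_affine_coproduct_def tensor_pure_bilinear
      tensor_pure_mult tensor_pure_one\<close>)
  have tens: "C.tens = fps_tensor"
    by (simp add: fun_eq_iff C.tens_def fps_tensor_def fps_pairing_def)
  note tens_linear = C.tens_linear[unfolded tens]
  have norm: "normalized_fps e a $ 0 = 1" "normalized_fps e b $ 0 =
      1" "normalized_fps e (a * b) $ 0 = 1" for e
    using assms by (simp_all add: normalized_fps_nth_0 coeff_mult_0)
  have com: "fps_scalars N * W = W * (fps_scalars N :: 'u fps)" for N W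
    by (rule fps_scalars_commute)
  have sc: "(fps_scalars N :: 'u fps) $ 0 = 1" if "N $ 0 = 1" for N
    using that by (simp add: fps_scalars_nth scaleC_one)

  \<comment> \<open>The formula at positive sign\<close>
  have Pos: "D.A_solution (fps_scalars (normalized_fps Pos c)) (A_series q \<phi> Pos c)"
    if "normalized_fps Pos c $ 0 = 1" for c
    using D.A_series_solution[OF normalized_poly_series_eq that]
    by (simp add: D.A_solution_def normalized_poly_series_eq power2_eq_square)
  have "fps_map \<Delta> (A_series q \<phi> Pos (a * b)) = fps_tensor (A_series q \<phi> Pos a) (A_series q \<phi> Pos b)
      + zmul (q *\<^sub>C fps_tensor (qbracket q (A_series q \<phi> Pos a) (D.Y 1)) (qbracket q (D.X 1) (A_series q \<phi> Pos b)))"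
    using C.coproduct_A_solution[OF Pos[OF norm(1)] norm(1) Pos[OF norm(2)] norm(2)]
      Pos[OF norm(3)] by (simp add: normalized_fps_mult tens)
  moreover have "commutator (A_series q \<phi> Pos a) (fps_const (x Neg 0)) =
      zmul (qbracket q (A_series q \<phi> Pos a) (D.Y 1))"
    using D.A_solution_Y[OF Pos[OF norm(1)] com sc[OF norm(1)], of 0] by (simp add: commutator_def D.Y_def)
  moreover have "commutator (fps_const (x Pos (- 1))) (A_series q \<phi> Pos b) =
      zmul (qbracket q (D.X 1) (A_series q \<phi> Pos b))"
    using D.A_solution_X[OF Pos[OF norm(2)] com sc[OF norm(2)], of 0] by (simp add: commutator_def D.X_def)
  ultimately have pos: "fps_to_fls (fps_map \<Delta> (A_series q \<phi> Pos (a * b))) =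
       fps_to_fls (fps_tensor (A_series q \<phi> Pos a) (A_series q \<phi> Pos b))
       + fls_const (q *\<^sub>C 1) * fls_X_inv *
         fps_to_fls (fps_tensor
           (commutator (A_series q \<phi> Pos a) (fps_const (x Neg 0)))
           (commutator (fps_const (x Pos (-1))) (A_series q \<phi> Pos b)))"
    by (simp only: fps_to_fls_add_zmul tens_linear)

  \<comment> \<open>The formula at negative sign\<close>
  interpret O: coproduct q "\<lambda>s m. x (opp s) (- m)" "\<lambda>e m. \<phi> (opp e) (- m)" "\<lambda>u v. v \<otimes>\<^sub>C u" \<Delta>
    by (rule C.coproduct_opp)
  have tens': "O.tens F G = fps_tensor G F" for F G
  proof (rule fps_ext)
    fix n
    show "O.tens F G $ n = fps_tensor G F $ n"
      unfolding O.tens_def fps_tensor_def fps_pairing_def fps_nth_Abs_fps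
      by (rule sum.reindex_bij_witness[of _ "\<lambda>i. n - i" "\<lambda>i. n - i"]) auto
  qed
  \<comment> \<open>With w = z^-1, the equation at negative sign pairs A(w) with A(q^-2 w), whereas
    \<open>A_solution\<close> pairs a series with its dilation by q^2. So A(q^-2 w) is the solution,
    and dilating it recovers A.\<close>
  define B where "B c = fps_dilate (inverse q * inverse q) (A_series q \<phi> Neg c)" for c
  have dil: "qdilate q (B c) = A_series q \<phi> Neg c" for c
  proof -
    have "q * q * (inverse q * inverse q) = 1" using assms(1) by (simp add: field_simps)
    then show ?thesis
      by (simp add: B_def fps_eq_iff scaleC_scaleC scaleC_one flip: power_mult_distrib)
  qed
  have Neg: "O.A_solution (fps_scalars (normalized_fps Neg c)) (B c)"
    if "normalized_fps Neg c $ 0 = 1" for c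
  proof -
    note sol = D.A_series_solution[OF normalized_poly_series_eq that]
    have gens: "{\<phi> (opp s) (- m) | s m. True} = {\<phi> s m | s m. True}"
    proof -
      have "\<phi> s m = \<phi> (opp (opp s)) (- (- m))" for s m
        by (cases s) simp_all
      then show ?thesis by blast
    qed
    have "B c * A_series q \<phi> Neg c = A_series q \<phi> Neg c * B c"
      by (rule D.subalgebra_series_commute)
        (use sol in \<open>simp_all add: B_def generated_subalgebra.scale\<close>)
    moreover have "phi_series (\<lambda>e m. \<phi> (opp e) (- m)) Pos = phi_series \<phi> Neg"
      by (simp add: phi_series_def)
    ultimately show ?thesis
      using sol unfolding O.A_solution_def gens dil
      by (simp add: B_def normalized_poly_series_eq power2_eq_square power_int_minus scaleC_one
          generated_subalgebra.scale)
  qed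
  let ?e = "qbracket q (O.X 1) (B a)" and ?f = "qbracket q (B b) (O.Y 1)"
  \<comment> \<open>The solutions for b and a are entered in this order because reversal flips the
    tensor factors.\<close>
  have "fps_map \<Delta> (B (a * b)) = fps_tensor (B a) (B b) + zmul (q *\<^sub>C fps_tensor ?e ?f)"
    using O.coproduct_A_solution[OF Neg[OF norm(2)] norm(2) Neg[OF norm(1)] norm(1)]
      Neg[OF norm(3)] by (simp add: normalized_fps_mult tens' mult.commute)
  from arg_cong[OF this, of "qdilate q"]
  have "fps_map \<Delta> (A_series q \<phi> Neg (a * b)) = fps_tensor (A_series q \<phi> Neg a) (A_series q \<phi> Neg b)
      + zmul (q *\<^sub>C q *\<^sub>C q *\<^sub>C fps_tensor (qdilate q ?e) (qdilate q ?f))"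
    by (simp add: fps_map_hom(3)[OF hom, symmetric] fps_dilate_linear dil C.tens_dilate[unfolded tens]
        flip: scaleC_scaleC)
  \<comment> \<open>Dilation has produced q^3, rewritten as q^-1 q^4 so that each commutator can
    absorb one q^2.\<close>
  also have "q *\<^sub>C q *\<^sub>C q *\<^sub>C fps_tensor (qdilate q ?e) (qdilate q ?f) =
      inverse q *\<^sub>C q *\<^sub>C q *\<^sub>C q *\<^sub>C q *\<^sub>C fps_tensor (qdilate q ?e) (qdilate q ?f)"
    by (simp add: D.q_cancel)
  finally have neg: "fps_map \<Delta> (A_series q \<phi> Neg (a * b)) =
      fps_tensor (A_series q \<phi> Neg a) (A_series q \<phi> Neg b) + zmul (inverse q *\<^sub>C q *\<^sub>C q *\<^sub>C q *\<^sub>C q *\<^sub>C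
        fps_tensor (qdilate q ?e) (qdilate q ?f))" .
  \<comment> \<open>For the reversed generators \<open>O.X 0\<close> is x^-_1 and
    \<open>O.Y 0\<close> is x^+_0. Both commutators acquire a sign, and the signs cancel in the
    tensor product.\<close>
  have e: "commutator (A_series q \<phi> Neg a) (fps_const (x Neg 1)) =
      - zmul (q *\<^sub>C q *\<^sub>C qdilate q ?e)"
    using arg_cong[OF O.A_solution_X[OF Neg[OF norm(1)] com sc[OF norm(1)], of 0], of "qdilate q"]
    by (simp add: commutator_def O.X_def[of 0] dil fps_dilate_linear fps_dilate_mult scaleC_scaleC)
  have f: "commutator (fps_const (x Pos 0)) (A_series q \<phi> Neg b) =
      - zmul (q *\<^sub>C q *\<^sub>C qdilate q ?f)"
    using arg_cong[OF O.A_solution_Y[OF Neg[OF norm(2)] com sc[OF norm(2)], of 0], of "qdilate q"]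
    by (simp add: commutator_def O.Y_def[of 0] dil fps_dilate_linear fps_dilate_mult scaleC_scaleC)
  have tens_minus: "fps_tensor (- F) (- G) = fps_tensor F G" for F G :: "'u fps"
    using tens_linear(3)[of "- 1" F "- G"] tens_linear(4)[of F "- 1" G] by simp
  have "fps_to_fls (fps_map \<Delta> (A_series q \<phi> Neg (a * b))) =
       fps_to_fls (fps_tensor (A_series q \<phi> Neg a) (A_series q \<phi> Neg b))
       + fls_const (inverse q *\<^sub>C 1) * fls_X_inv *
         fps_to_fls (fps_tensor
           (commutator (A_series q \<phi> Neg a) (fps_const (x Neg 1)))
           (commutator (fps_const (x Pos 0)) (A_series q \<phi> Neg b)))"
    unfolding neg e f by (simp only: fps_to_fls_add_zmul tens_minus tens_linear zmul_linear)
  with pos show ?thesis by blast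
qed

end
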